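(* Let $(N,\hat\omega)$ be an almost symplectic submanifold of an almost Fedosov manifold $(M,\omega,\nabla^\omega)$, with second fundamental form $\alpha(X,Y)=(\nabla^\omega_XY)^\perp$ and induced connection $\tilde\nabla_XY=(\nabla^\omega_XY)^\top$. Then $$\alpha(X,Y)-\alpha(Y,X)=(T^\omega(X,Y))^\perp,\qquad X,Y\in\Gamma(TN),$$ where $T^\omega$ is the torsion of $\nabla^\omega$. Moreover the torsion $\tilde T$ of $\tilde\nabla$ satisfies $$\tilde T(X,Y)=(T^\omega(X,Y))^\top,\qquad X,Y\in\Gamma(TN).$$
   Context: An almost symplectic manifold $(M,\omega)$ is a manifold with a non-degenerate 2-form $\omega$. An almost Fedosov manifold $(M,\omega,\nabla^\omega)$ is an almost symplectic manifold with an affine connection $\nabla^\omega$ such that $\nabla^\omega\omega=0$ (standing assumption: $\dim M>4$). A submanifold $\iota:N\to M$ (immersion) is almost symplectic if $\hat\omega:=\iota^*\omega$ is non-degenerate on $N$. Then $TM|_N=TN\oplus\nu(N)$, where $\nu_x(N)=(T_xN)^{\perp_\omega}=\{u\in T_xM:\omega(u,v)=0\ \forall v\in T_xN\}$; $\top$ and $\perp$ denote the projections onto $TN$ and $\nu(N)$. *)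

theory Defs
  imports "HOL-Analysis.Analysis"
begin

section \<open>Smooth maps between open subsets of Euclidean spaces\<close>

text \<open>Only used for open \<open>S\<close>, where derivatives within \<open>S\<close> are ordinary derivatives.\<close>

primrec Ck_on :: "nat \<Rightarrow> 'a::real_normed_vector set \<Rightarrow> ('a \<Rightarrow> 'b::real_normed_vector) \<Rightarrow> bool" where
  "Ck_on 0 S f \<longleftrightarrow> continuous_on S f"
| "Ck_on (Suc k) S f \<longleftrightarrow>
     f differentiable_on S \<and> (\<forall>v. Ck_on k S (\<lambda>x. frechet_derivative f (at x) v))"

definition smooth_on :: "'a::real_normed_vector set \<Rightarrow> ('a \<Rightarrow> 'b::real_normed_vector) \<Rightarrow> bool" where
  "smooth_on S f \<longleftrightarrow> (\<forall>k. Ck_on k S f)"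


section \<open>Smooth manifolds\<close>

text \<open>A chart is a pair \<open>(U, \<phi>)\<close>; only the values of \<open>\<phi>\<close> on \<open>U\<close> matter. The points of the
  manifold are all elements of the type \<open>'m\<close>, and its dimension is \<open>DIM('a)\<close>.\<close>

type_synonym ('m, 'a) atlas = "('m set \<times> ('m \<Rightarrow> 'a)) set"

definition smooth_manifold ::
  "('m::{t2_space,second_countable_topology}, 'a::euclidean_space) atlas \<Rightarrow> bool" where
  "smooth_manifold A \<longleftrightarrow>
     (\<Union>(U, \<phi>)\<in>A. U) = UNIV \<and>
     (\<forall>(U, \<phi>)\<in>A. open U \<and> open (\<phi> ` U) \<and> homeomorphism U (\<phi> ` U) \<phi> (inv_into U \<phi>)) \<and>
     (\<forall>(U, \<phi>)\<in>A. \<forall>(V, \<psi>)\<in>A. smooth_on (\<phi> ` (U \<inter> V)) (\<psi> \<circ> inv_into U \<phi>))"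

definition smooth_fun ::
  "('m, 'a::euclidean_space) atlas \<Rightarrow> 'm set \<Rightarrow> ('m \<Rightarrow> 'c::real_normed_vector) \<Rightarrow> bool" where
  "smooth_fun A S f \<longleftrightarrow> (\<forall>(U, \<phi>)\<in>A. smooth_on (\<phi> ` (S \<inter> U)) (f \<circ> inv_into U \<phi>))"

definition smooth_map ::
  "('n::topological_space, 'b::euclidean_space) atlas \<Rightarrow>
   ('m::topological_space, 'a::euclidean_space) atlas \<Rightarrow> ('n \<Rightarrow> 'm) \<Rightarrow> bool" where
  "smooth_map B A \<iota> \<longleftrightarrow> continuous_on UNIV \<iota> \<and>
     (\<forall>(U, \<phi>)\<in>B. \<forall>(V, \<psi>)\<in>A. smooth_on (\<phi> ` (U \<inter> \<iota> -` V)) (\<psi> \<circ> \<iota> \<circ> inv_into U \<phi>))"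


section \<open>Tangent vectors\<close>

text \<open>For each point \<open>p\<close> we choose once and for all a chart around \<open>p\<close> and represent a tangent
  vector at \<open>p\<close> by its components in that chart. Thus every tangent space is a copy of the model
  space \<open>'a\<close>, and a vector field is a function \<open>'m \<Rightarrow> 'a\<close>. As the chosen chart varies with
  \<open>p\<close> in an uncontrolled way, smoothness of a vector field has to be tested on its components in
  the charts of the atlas, and all derivatives refer to the chosen chart at the given point.\<close>

definition chart_at :: "('m, 'a) atlas \<Rightarrow> 'm \<Rightarrow> 'm set \<times> ('m \<Rightarrow> 'a)" where
  "chart_at A p = (SOME c. c \<in> A \<and> p \<in> fst c)"

definition coord :: "('m, 'a) atlas \<Rightarrow> 'm \<Rightarrow> 'm \<Rightarrow> 'a" where
  "coord A p = snd (chart_at A p)"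

definition coord_inv :: "('m, 'a) atlas \<Rightarrow> 'm \<Rightarrow> 'a \<Rightarrow> 'm" where
  "coord_inv A p = inv_into (fst (chart_at A p)) (snd (chart_at A p))"

text \<open>The derivative \<open>v(f)\<close> of a function \<open>f\<close> in the direction of a tangent vector \<open>v\<close> at \<open>p\<close>.\<close>

definition vec_deriv ::
  "('m, 'a::euclidean_space) atlas \<Rightarrow> 'm \<Rightarrow> 'a \<Rightarrow> ('m \<Rightarrow> 'c::real_normed_vector) \<Rightarrow> 'c" where
  "vec_deriv A p v f = frechet_derivative (f \<circ> coord_inv A p) (at (coord A p p)) v"

definition tangent_map ::
  "('n, 'b::euclidean_space) atlas \<Rightarrow> ('m, 'a::euclidean_space) atlas \<Rightarrow> ('n \<Rightarrow> 'm) \<Rightarrow> 'n \<Rightarrow> 'b \<Rightarrow> 'a" where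
  "tangent_map B A \<iota> p v = vec_deriv B p v (coord A (\<iota> p) \<circ> \<iota>)"

definition immersion ::
  "('n::topological_space, 'b::euclidean_space) atlas \<Rightarrow>
   ('m::topological_space, 'a::euclidean_space) atlas \<Rightarrow> ('n \<Rightarrow> 'm) \<Rightarrow> bool" where
  "immersion B A \<iota> \<longleftrightarrow> smooth_map B A \<iota> \<and> (\<forall>p. inj (tangent_map B A \<iota> p))"

text \<open>The components of \<open>X p\<close> in a chart \<open>(U, \<phi>)\<close> are the derivative of \<open>\<phi>\<close> along \<open>X p\<close>.\<close>

definition smooth_vf :: "('m, 'a::euclidean_space) atlas \<Rightarrow> 'm set \<Rightarrow> ('m \<Rightarrow> 'a) \<Rightarrow> bool" where
  "smooth_vf A S X \<longleftrightarrow>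
     (\<forall>(U, \<phi>)\<in>A. smooth_on (\<phi> ` (S \<inter> U)) ((\<lambda>p. vec_deriv A p (X p) \<phi>) \<circ> inv_into U \<phi>))"

definition sections :: "('m, 'a::euclidean_space) atlas \<Rightarrow> ('m \<Rightarrow> 'a) set" where
  "sections A = {X. smooth_vf A UNIV X}"

definition lie_bracket ::
  "('m::topological_space, 'a::euclidean_space) atlas \<Rightarrow> ('m \<Rightarrow> 'a) \<Rightarrow> ('m \<Rightarrow> 'a) \<Rightarrow> 'm \<Rightarrow> 'a" where
  "lie_bracket A X Y p =
     (THE w. \<forall>S. \<forall>f :: 'm \<Rightarrow> real. open S \<longrightarrow> p \<in> S \<longrightarrow> smooth_fun A S f \<longrightarrow>
        vec_deriv A p w f =
          vec_deriv A p (X p) (\<lambda>q. vec_deriv A q (Y q) f) -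
          vec_deriv A p (Y p) (\<lambda>q. vec_deriv A q (X q) f))"


section \<open>Affine connections and torsion\<close>

text \<open>\<open>nabla p v Y\<close> is the covariant derivative at \<open>p\<close> of \<open>Y\<close> in the direction \<open>v\<close>. It is
  meaningful for every field that is smooth near \<open>p\<close>; the first clause says that it depends
  only on the germ of that field at \<open>p\<close>. Homogeneity in \<open>Y\<close> over the reals is the case of a
  constant \<open>f\<close> in the Leibniz rule.\<close>

type_synonym ('m, 'a) conn = "'m \<Rightarrow> 'a \<Rightarrow> ('m \<Rightarrow> 'a) \<Rightarrow> 'a"

definition affine_connection ::
  "('m::topological_space, 'a::euclidean_space) atlas \<Rightarrow> ('m, 'a) conn \<Rightarrow> bool" where
  "affine_connection A nabla \<longleftrightarrow>
     (\<forall>S Y Z. open S \<longrightarrow> smooth_vf A S Y \<longrightarrow> smooth_vf A S Z \<longrightarrow> (\<forall>q\<in>S. Y q = Z q) \<longrightarrow>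
        (\<forall>p\<in>S. \<forall>v. nabla p v Y = nabla p v Z)) \<and>
     (\<forall>S Y. open S \<longrightarrow> smooth_vf A S Y \<longrightarrow> (\<forall>p\<in>S. linear (\<lambda>v. nabla p v Y))) \<and>
     (\<forall>S Y Z. open S \<longrightarrow> smooth_vf A S Y \<longrightarrow> smooth_vf A S Z \<longrightarrow>
        (\<forall>p\<in>S. \<forall>v. nabla p v (\<lambda>q. Y q + Z q) = nabla p v Y + nabla p v Z)) \<and>
     (\<forall>S f Y. open S \<longrightarrow> smooth_fun A S f \<longrightarrow> smooth_vf A S Y \<longrightarrow>
        (\<forall>p\<in>S. \<forall>v. nabla p v (\<lambda>q. f q *\<^sub>R Y q) =
           vec_deriv A p v f *\<^sub>R Y p + f p *\<^sub>R nabla p v Y)) \<and>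
     (\<forall>S X Y. open S \<longrightarrow> smooth_vf A S X \<longrightarrow> smooth_vf A S Y \<longrightarrow>
        smooth_vf A S (\<lambda>p. nabla p (X p) Y))"

definition torsion ::
  "('m::topological_space, 'a::euclidean_space) atlas \<Rightarrow> ('m, 'a) conn \<Rightarrow>
   ('m \<Rightarrow> 'a) \<Rightarrow> ('m \<Rightarrow> 'a) \<Rightarrow> 'm \<Rightarrow> 'a" where
  "torsion A nabla X Y p = nabla p (X p) Y - nabla p (Y p) X - lie_bracket A X Y p"

text \<open>The torsion as a tensor, i.e. on individual tangent vectors at \<open>p\<close>, obtained by extending
  these to vector fields near \<open>p\<close>.\<close>

definition torsion_tensor ::
  "('m::topological_space, 'a::euclidean_space) atlas \<Rightarrow> ('m, 'a) conn \<Rightarrow> 'm \<Rightarrow> 'a \<Rightarrow> 'a \<Rightarrow> 'a" where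
  "torsion_tensor A nabla p u v =
     (THE w. \<exists>S X Y. open S \<and> p \<in> S \<and> smooth_vf A S X \<and> smooth_vf A S Y \<and>
        X p = u \<and> Y p = v \<and> w = torsion A nabla X Y p)"


section \<open>Almost symplectic and almost Fedosov manifolds\<close>

definition nondegenerate :: "('m \<Rightarrow> 'a::real_vector \<Rightarrow> 'a \<Rightarrow> real) \<Rightarrow> bool" where
  "nondegenerate \<omega> \<longleftrightarrow> (\<forall>p u. (\<forall>v. \<omega> p u v = 0) \<longrightarrow> u = 0)"

definition two_form ::
  "('m::topological_space, 'a::euclidean_space) atlas \<Rightarrow> ('m \<Rightarrow> 'a \<Rightarrow> 'a \<Rightarrow> real) \<Rightarrow> bool" where
  "two_form A \<omega> \<longleftrightarrow>
     (\<forall>p. bilinear (\<omega> p) \<and> (\<forall>u v. \<omega> p u v = - \<omega> p v u)) \<and>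
     (\<forall>S X Y. open S \<longrightarrow> smooth_vf A S X \<longrightarrow> smooth_vf A S Y \<longrightarrow>
        smooth_fun A S (\<lambda>p. \<omega> p (X p) (Y p)))"

definition almost_symplectic ::
  "('m::{t2_space,second_countable_topology}, 'a::euclidean_space) atlas \<Rightarrow>
   ('m \<Rightarrow> 'a \<Rightarrow> 'a \<Rightarrow> real) \<Rightarrow> bool" where
  "almost_symplectic A \<omega> \<longleftrightarrow> smooth_manifold A \<and> two_form A \<omega> \<and> nondegenerate \<omega>"

definition parallel_form ::
  "('m::topological_space, 'a::euclidean_space) atlas \<Rightarrow> ('m, 'a) conn \<Rightarrow>
   ('m \<Rightarrow> 'a \<Rightarrow> 'a \<Rightarrow> real) \<Rightarrow> bool" where
  "parallel_form A nabla \<omega> \<longleftrightarrow>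
     (\<forall>S X Y. open S \<longrightarrow> smooth_vf A S X \<longrightarrow> smooth_vf A S Y \<longrightarrow>
        (\<forall>p\<in>S. \<forall>v. vec_deriv A p v (\<lambda>q. \<omega> q (X q) (Y q)) -
           \<omega> p (nabla p v X) (Y p) - \<omega> p (X p) (nabla p v Y) = 0))"

definition almost_fedosov ::
  "('m::{t2_space,second_countable_topology}, 'a::euclidean_space) atlas \<Rightarrow>
   ('m \<Rightarrow> 'a \<Rightarrow> 'a \<Rightarrow> real) \<Rightarrow> ('m, 'a) conn \<Rightarrow> bool" where
  "almost_fedosov A \<omega> nabla \<longleftrightarrow>
     almost_symplectic A \<omega> \<and> affine_connection A nabla \<and> parallel_form A nabla \<omega>"


section \<open>Almost symplectic submanifolds\<close>

definition pullback_form ::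
  "('n, 'b::euclidean_space) atlas \<Rightarrow> ('m, 'a::euclidean_space) atlas \<Rightarrow> ('n \<Rightarrow> 'm) \<Rightarrow>
   ('m \<Rightarrow> 'a \<Rightarrow> 'a \<Rightarrow> real) \<Rightarrow> 'n \<Rightarrow> 'b \<Rightarrow> 'b \<Rightarrow> real" where
  "pullback_form B A \<iota> \<omega> p u v = \<omega> (\<iota> p) (tangent_map B A \<iota> p u) (tangent_map B A \<iota> p v)"

definition almost_symplectic_submanifold ::
  "('n::{t2_space,second_countable_topology}, 'b::euclidean_space) atlas \<Rightarrow>
   ('m::{t2_space,second_countable_topology}, 'a::euclidean_space) atlas \<Rightarrow>
   ('m \<Rightarrow> 'a \<Rightarrow> 'a \<Rightarrow> real) \<Rightarrow> ('n \<Rightarrow> 'm) \<Rightarrow> bool" where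
  "almost_symplectic_submanifold B A \<omega> \<iota> \<longleftrightarrow>
     smooth_manifold B \<and> immersion B A \<iota> \<and> nondegenerate (pullback_form B A \<iota> \<omega>)"

text \<open>\<open>T\<^sub>pN\<close> and \<open>\<nu>\<^sub>p(N)\<close> as subspaces of the tangent space of the ambient manifold at \<open>\<iota> p\<close>.\<close>

definition tangent_sub ::
  "('n, 'b::euclidean_space) atlas \<Rightarrow> ('m, 'a::euclidean_space) atlas \<Rightarrow> ('n \<Rightarrow> 'm) \<Rightarrow> 'n \<Rightarrow> 'a set" where
  "tangent_sub B A \<iota> p = range (tangent_map B A \<iota> p)"

definition normal_sub ::
  "('n, 'b::euclidean_space) atlas \<Rightarrow> ('m, 'a::euclidean_space) atlas \<Rightarrow>
   ('m \<Rightarrow> 'a \<Rightarrow> 'a \<Rightarrow> real) \<Rightarrow> ('n \<Rightarrow> 'm) \<Rightarrow> 'n \<Rightarrow> 'a set" where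
  "normal_sub B A \<omega> \<iota> p = {u. \<forall>v \<in> tangent_sub B A \<iota> p. \<omega> (\<iota> p) u v = 0}"

definition tan_part ::
  "('n, 'b::euclidean_space) atlas \<Rightarrow> ('m, 'a::euclidean_space) atlas \<Rightarrow>
   ('m \<Rightarrow> 'a \<Rightarrow> 'a \<Rightarrow> real) \<Rightarrow> ('n \<Rightarrow> 'm) \<Rightarrow> 'n \<Rightarrow> 'a \<Rightarrow> 'a" where
  "tan_part B A \<omega> \<iota> p u =
     (THE t. t \<in> tangent_sub B A \<iota> p \<and> u - t \<in> normal_sub B A \<omega> \<iota> p)"

definition nor_part ::
  "('n, 'b::euclidean_space) atlas \<Rightarrow> ('m, 'a::euclidean_space) atlas \<Rightarrow>
   ('m \<Rightarrow> 'a \<Rightarrow> 'a \<Rightarrow> real) \<Rightarrow> ('n \<Rightarrow> 'm) \<Rightarrow> 'n \<Rightarrow> 'a \<Rightarrow> 'a" where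
  "nor_part B A \<omega> \<iota> p u =
     (THE n. n \<in> normal_sub B A \<omega> \<iota> p \<and> u - n \<in> tangent_sub B A \<iota> p)"

text \<open>The ambient covariant derivative, at \<open>\<iota> p\<close> and in the direction of a tangent vector \<open>v\<close> of
  the submanifold at \<open>p\<close>, of a vector field \<open>Y\<close> on the submanifold: since \<open>\<iota>\<close> is an immersion,
  \<open>Y\<close> has an extension \<open>Y'\<close> to a vector field near \<open>\<iota> p\<close> that agrees with \<open>Y\<close> (pushed forward)
  on a neighbourhood \<open>W\<close> of \<open>p\<close> in the submanifold, and the value does not depend on it.\<close>

definition conn_along ::
  "('n::topological_space, 'b::euclidean_space) atlas \<Rightarrow>
   ('m::topological_space, 'a::euclidean_space) atlas \<Rightarrow> ('n \<Rightarrow> 'm) \<Rightarrow> ('m, 'a) conn \<Rightarrow>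
   'n \<Rightarrow> 'b \<Rightarrow> ('n \<Rightarrow> 'b) \<Rightarrow> 'a" where
  "conn_along B A \<iota> nabla p v Y =
     (THE w. \<exists>S W Y'. open S \<and> \<iota> p \<in> S \<and> smooth_vf A S Y' \<and> open W \<and> p \<in> W \<and>
        (\<forall>q\<in>W. \<iota> q \<in> S \<and> Y' (\<iota> q) = tangent_map B A \<iota> q (Y q)) \<and>
        w = nabla (\<iota> p) (tangent_map B A \<iota> p v) Y')"

definition second_fundamental_form ::
  "('n::topological_space, 'b::euclidean_space) atlas \<Rightarrow>
   ('m::topological_space, 'a::euclidean_space) atlas \<Rightarrow>
   ('m \<Rightarrow> 'a \<Rightarrow> 'a \<Rightarrow> real) \<Rightarrow> ('n \<Rightarrow> 'm) \<Rightarrow> ('m, 'a) conn \<Rightarrow>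
   ('n \<Rightarrow> 'b) \<Rightarrow> ('n \<Rightarrow> 'b) \<Rightarrow> 'n \<Rightarrow> 'a" where
  "second_fundamental_form B A \<omega> \<iota> nabla X Y p =
     nor_part B A \<omega> \<iota> p (conn_along B A \<iota> nabla p (X p) Y)"

definition induced_connection ::
  "('n::topological_space, 'b::euclidean_space) atlas \<Rightarrow>
   ('m::topological_space, 'a::euclidean_space) atlas \<Rightarrow>
   ('m \<Rightarrow> 'a \<Rightarrow> 'a \<Rightarrow> real) \<Rightarrow> ('n \<Rightarrow> 'm) \<Rightarrow> ('m, 'a) conn \<Rightarrow> ('n, 'b) conn" where
  "induced_connection B A \<omega> \<iota> nabla p v Y =
     (THE w. tangent_map B A \<iota> p w = tan_part B A \<omega> \<iota> p (conn_along B A \<iota> nabla p v Y))"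

end

theory Submission
  imports Defs
begin

text \<open>
  In the chosen chart at \<open>p\<close> a connection has the form
  \<open>\<nabla>\<^sub>v X = dX(v) + \<Gamma>(v, X p)\<close>, and the bracket is \<open>[X, Y] = dY(X) - dX(Y)\<close>, so
  \<open>T(u, v) = \<Gamma>(u, v) - \<Gamma>(v, u)\<close>. For fields \<open>X, Y\<close> on the submanifold, the chain rule and the
  symmetry of the second derivative of the local representative of \<open>\<iota>\<close> give
  \<open>\<nabla>\<^sub>X Y - \<nabla>\<^sub>Y X = d\<iota>([X, Y]) + T(d\<iota> X, d\<iota> Y)\<close>; since \<open>d\<iota>([X, Y])\<close> is tangent to the
  submanifold, the two projections of this identity are the two claims. That \<open>\<nabla>\<^sub>X Y\<close> makes sense along
  the immersion at all rests on extending fields off the submanifold, which needs the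
  smooth inverse function theorem.
\<close>

section \<open>Calculus of \<open>C\<^sup>k\<close> maps\<close>

text \<open>One obstacle is that a field refers at each point to a chart of its own, so it cannot be
  differentiated as it stands. Near a fixed \<open>p\<close> everything is therefore rewritten in
  the one chart chosen at \<open>p\<close> (\<open>components\<close>, \<open>local_rep\<close>,
  \<open>push_components\<close>), and results are compared at \<open>p\<close> alone, where
  components and tangent vector coincide. The other is that bracket, torsion tensor, derivative
  along \<open>\<iota>\<close>, projections and induced connection are definite descriptions, so
  each needs existence and uniqueness. A formula free of the auxiliary choices gives uniqueness, a
  witness gives existence. For the derivative along \<open>\<iota>\<close> that formula uses the
  field only through data on the submanifold, while the witness is the hard half: an immersion need
  not be injective, so an extension can only be asked to agree with the field near \<open>p\<close>
  in the submanifold. The inverse function theorem invoked for it yields a differentiable inverse;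
  smoothness follows by bootstrapping on the derivative of that inverse.\<close>

abbreviation D :: "('a::real_normed_vector \<Rightarrow> 'b::real_normed_vector) \<Rightarrow> 'a \<Rightarrow> 'a \<Rightarrow> 'b" where
  "D f x \<equiv> frechet_derivative f (at x)"

lemma D_eqI: "(f has_derivative f') (at x) \<Longrightarrow> D f x = f'"
  using frechet_derivative_at by metis

text \<open>\<open>frechet_derivative\<close> is a choice among all \<open>f'\<close> satisfying the
  derivative predicate, and that predicate is the same for functions agreeing near \<open>x\<close>.
  So the equality holds even at points without a derivative.\<close>

lemma D_cong:
  assumes "open S" "x \<in> S" "\<And>y. y \<in> S \<Longrightarrow> f y = g y"
  shows "D f x = D g x"
proof -
  have "(f has_derivative f') (at x) \<longleftrightarrow> (g has_derivative f') (at x)" for f'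
    using assms by (metis has_derivative_transform_within_open)
  then show ?thesis
    by (simp add: frechet_derivative_def)
qed

lemma Ck_on_cong:
  assumes "open S" "\<And>x. x \<in> S \<Longrightarrow> f x = g x" "Ck_on k S f"
  shows "Ck_on k S g"
  using assms(2,3)
proof (induction k arbitrary: f g)
  case 0
  then show ?case
    by (simp cong: continuous_on_cong)
next
  case (Suc k)
  have "g differentiable_on S"
    using Suc.prems unfolding differentiable_on_def differentiable_def
    by (metis Ck_on.simps(2) differentiable_def differentiable_on_def has_derivative_transform)
  moreover have "Ck_on k S (\<lambda>x. D g x v)" for v
  proof (rule Suc.IH)
    show "Ck_on k S (\<lambda>x. D f x v)"
      using Suc.prems(2) by simp
    show "D f x v = D g x v" if "x \<in> S" for x
      using D_cong[OF assms(1) that Suc.prems(1)] by simp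
  qed
  ultimately show ?case
    by simp
qed

text \<open>Allows an explicit derivative formula to replace \<open>frechet_derivative\<close>; the
  closure lemmas below are inductions on \<open>k\<close> through this rule.\<close>

lemma Ck_on_SucI:
  assumes "open S" "\<And>x. x \<in> S \<Longrightarrow> (f has_derivative f' x) (at x)" "\<And>v. Ck_on k S (\<lambda>x. f' x v)"
  shows "Ck_on (Suc k) S f"
proof -
  have "f differentiable_on S"
    by (meson assms(2) differentiable_at_imp_differentiable_on differentiable_def)
  moreover have "Ck_on k S (\<lambda>x. D f x v)" for v
    by (rule Ck_on_cong[OF assms(1) _ assms(3)]) (simp add: D_eqI[OF assms(2)])
  ultimately show ?thesis
    by simp
qed

lemma Ck_on_has_derivative:
  assumes "open S" "Ck_on (Suc k) S f" "x \<in> S"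
  shows "(f has_derivative D f x) (at x)"
  using assms by (metis Ck_on.simps(2) at_within_open differentiable_on_def frechet_derivative_works)

lemma Ck_on_D: "Ck_on (Suc k) S f \<Longrightarrow> Ck_on k S (\<lambda>x. D f x v)"
  by simp

lemma Ck_on_subset: "Ck_on k S f \<Longrightarrow> T \<subseteq> S \<Longrightarrow> Ck_on k T f"
  by (induction k arbitrary: f) (auto intro: continuous_on_subset differentiable_on_subset)

lemma Ck_on_Suc_imp: "Ck_on (Suc k) S f \<Longrightarrow> Ck_on k S f"
  by (induction k arbitrary: f) (auto intro: differentiable_imp_continuous_on)

lemma Ck_on_const: "open S \<Longrightarrow> Ck_on k S (\<lambda>x. c)"
proof (induction k arbitrary: c)
  case (Suc k)
  show ?case
    by (rule Ck_on_SucI[where f' = "\<lambda>_ _. 0"]) (use Suc in auto)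
qed simp

lemma Ck_on_bounded_linear:
  assumes "bounded_linear L" "open S" "Ck_on k S f"
  shows "Ck_on k S (\<lambda>x. L (f x))"
  using assms(3)
proof (induction k arbitrary: f)
  case 0
  then show ?case
    using assms(1) by (simp add: bounded_linear.continuous_on)
next
  case (Suc k)
  show ?case
  proof (intro Ck_on_SucI[where f' = "\<lambda>x v. L (D f x v)"] \<open>open S\<close>)
    show "((\<lambda>x. L (f x)) has_derivative (\<lambda>v. L (D f x v))) (at x)" if "x \<in> S" for x
      using Ck_on_has_derivative[OF \<open>open S\<close> Suc.prems that] bounded_linear.has_derivative[OF assms(1)]
      by blast
    show "Ck_on k S (\<lambda>x. L (D f x v))" for v
      using Suc by simp
  qed
qed

lemma Ck_on_ident: "open S \<Longrightarrow> Ck_on k S (\<lambda>x. x)"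
proof (induction k)
  case (Suc k)
  show ?case
    by (rule Ck_on_SucI[where f' = "\<lambda>_ v. v"]) (use Suc in \<open>auto intro: Ck_on_const\<close>)
qed simp

lemma Ck_on_add:
  assumes "open S" "Ck_on k S f" "Ck_on k S g"
  shows "Ck_on k S (\<lambda>x. f x + g x)"
  using assms(2,3)
proof (induction k arbitrary: f g)
  case 0
  then show ?case
    by (simp add: continuous_on_add)
next
  case (Suc k)
  show ?case
  proof (intro Ck_on_SucI[where f' = "\<lambda>x v. D f x v + D g x v"] \<open>open S\<close>)
    show "((\<lambda>x. f x + g x) has_derivative (\<lambda>v. D f x v + D g x v)) (at x)" if "x \<in> S" for x
      by (rule has_derivative_add) (rule Ck_on_has_derivative[OF \<open>open S\<close> _ that] Suc.prems)+
  qed (use Suc in simp)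
qed

lemma Ck_on_sum:
  assumes "open S" "\<And>i. i \<in> I \<Longrightarrow> Ck_on k S (f i)"
  shows "Ck_on k S (\<lambda>x. \<Sum>i\<in>I. f i x)"
  using assms(2)
  by (induction I rule: infinite_finite_induct) (auto intro!: Ck_on_add Ck_on_const assms(1))

text \<open>The product rule pairs one factor with the derivative of the other, so the induction
  runs over both functions at once and the undifferentiated factor is weakened by one order.\<close>

lemma Ck_on_bilinear:
  assumes "bounded_bilinear pr" "open S" "Ck_on k S f" "Ck_on k S g"
  shows "Ck_on k S (\<lambda>x. pr (f x) (g x))"
  using assms(3,4)
proof (induction k arbitrary: f g)
  case 0
  then show ?case
    using assms(1) by (simp add: bounded_bilinear.continuous_on)
next
  case (Suc k)
  show ?case
  proof (intro Ck_on_SucI[where f' = "\<lambda>x v. pr (f x) (D g x v) + pr (D f x v) (g x)"] \<open>open S\<close>)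
    show "((\<lambda>x. pr (f x) (g x)) has_derivative (\<lambda>v. pr (f x) (D g x v) + pr (D f x v) (g x))) (at x)"
      if "x \<in> S" for x
      by (rule bounded_bilinear.FDERIV[OF assms(1)])
        (rule Ck_on_has_derivative[OF \<open>open S\<close> _ that] Suc.prems)+
    show "Ck_on k S (\<lambda>x. pr (f x) (D g x v) + pr (D f x v) (g x))" for v
      using Suc.prems by (intro Ck_on_add Suc.IH \<open>open S\<close>) (auto intro: Ck_on_Suc_imp)
  qed
qed

lemmas Ck_on_scaleR = Ck_on_bilinear[OF bounded_bilinear_scaleR]
  and Ck_on_inner_const = Ck_on_bounded_linear[OF bounded_linear_inner_left]

lemma linear_euclidean_expand:
  fixes u :: "'a::euclidean_space"
  assumes "linear L"
  shows "L u = (\<Sum>b\<in>Basis. (u \<bullet> b) *\<^sub>R L b)"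
  by (metis (no_types, lifting) assms euclidean_representation linear_scale linear_sum sum.cong)

text \<open>\<open>Ck_on\<close> controls derivatives in constant directions only; a direction that
  varies with the point is reduced to these by expanding it in the basis.\<close>

lemma Ck_on_D_apply:
  fixes f :: "'a::euclidean_space \<Rightarrow> 'b::real_normed_vector"
  assumes "open S" "Ck_on (Suc k) S f" "Ck_on k S g"
  shows "Ck_on k S (\<lambda>x. D f x (g x))"
proof (rule Ck_on_cong[OF \<open>open S\<close>])
  show "Ck_on k S (\<lambda>x. \<Sum>b\<in>Basis. (g x \<bullet> b) *\<^sub>R D f x b)"
    using assms by (intro Ck_on_sum Ck_on_scaleR Ck_on_inner_const) auto
  show "(\<Sum>b\<in>Basis. (g x \<bullet> b) *\<^sub>R D f x b) = D f x (g x)" if "x \<in> S" for x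
    using linear_euclidean_expand has_derivative_linear[OF Ck_on_has_derivative[OF assms(1,2) that]]
    by metis
qed

text \<open>With the chain rule written as a sum over the basis, each summand contains
  \<open>D f (g x) b\<close>, again a composition with \<open>g\<close>, to which the induction
  hypothesis applies.\<close>

lemma Ck_on_compose:
  fixes f :: "'b::euclidean_space \<Rightarrow> 'c::real_normed_vector"
  assumes "open S" "open T" "g ` S \<subseteq> T" "Ck_on k S g" "Ck_on k T f"
  shows "Ck_on k S (\<lambda>x. f (g x))"
  using assms(4,5)
proof (induction k arbitrary: f)
  case 0
  then show ?case
    using assms(3) by (auto intro: continuous_on_compose2)
next
  case (Suc k)
  have df: "(f has_derivative D f (g x)) (at (g x))" and dg: "(g has_derivative D g x) (at x)"
    if "x \<in> S" for x
    using Ck_on_has_derivative[OF assms(2) Suc.prems(2)] Ck_on_has_derivative[OF assms(1) Suc.prems(1)]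
      assms(3) that by auto
  show ?case
  proof (intro Ck_on_SucI[where f' = "\<lambda>x v. \<Sum>b\<in>Basis. (D g x v \<bullet> b) *\<^sub>R D f (g x) b"] \<open>open S\<close>)
    fix x assume x: "x \<in> S"
    have "D f (g x) (D g x v) = (\<Sum>b\<in>Basis. (D g x v \<bullet> b) *\<^sub>R D f (g x) b)" for v
      by (rule linear_euclidean_expand[OF has_derivative_linear[OF df[OF x]]])
    then show "((\<lambda>x. f (g x)) has_derivative (\<lambda>v. \<Sum>b\<in>Basis. (D g x v \<bullet> b) *\<^sub>R D f (g x) b)) (at x)"
      using has_derivative_compose[OF dg[OF x] df[OF x]] by simp
  next
    show "Ck_on k S (\<lambda>x. \<Sum>b\<in>Basis. (D g x v \<bullet> b) *\<^sub>R D f (g x) b)" for v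
      using Suc.prems
      by (intro Ck_on_sum Ck_on_scaleR Ck_on_inner_const \<open>open S\<close> Suc.IH)
        (simp_all add: Ck_on_Suc_imp del: Ck_on.simps, simp_all)
  qed
qed

section \<open>Symmetry of second derivatives\<close>

lemma second_derivative_mvt:
  fixes f :: "'a::euclidean_space \<Rightarrow> real"
  assumes "open S" "Ck_on 2 S f" "0 < h"
    and S: "\<And>s t. 0 \<le> s \<Longrightarrow> s \<le> h \<Longrightarrow> 0 \<le> t \<Longrightarrow> t \<le> h \<Longrightarrow> x + s *\<^sub>R u + t *\<^sub>R v \<in> S"
  obtains s t where "0 < s" "s < h" "0 < t" "t < h"
    "f (x + h *\<^sub>R u + h *\<^sub>R v) - f (x + h *\<^sub>R u) - f (x + h *\<^sub>R v) + f x
      = h * h * D (\<lambda>y. D f y u) (x + s *\<^sub>R u + t *\<^sub>R v) v"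
proof -
  have C2: "Ck_on (Suc (Suc 0)) S f"
    using assms(2) by (simp only: numeral_2_eq_2)
  have df: "(f has_derivative D f y) (at y)" if "y \<in> S" for y
    using Ck_on_has_derivative[OF \<open>open S\<close> C2 that] .
  have ddf: "((\<lambda>y. D f y u) has_derivative D (\<lambda>y. D f y u) y) (at y)" if "y \<in> S" for y
    using Ck_on_has_derivative[OF \<open>open S\<close> Ck_on_D[OF C2] that] .
  have lin: "D f y (a *\<^sub>R u) = a * D f y u" if "y \<in> S" for y a
    using has_derivative_linear[OF df[OF that]] by (simp add: linear_scale)
  have lin2: "D (\<lambda>y. D f y u) y (a *\<^sub>R v) = a * D (\<lambda>y. D f y u) y v" if "y \<in> S" for y a
    using has_derivative_linear[OF ddf[OF that]] by (simp add: linear_scale)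
  \<comment> \<open>The increment across the edge \<open>h *\<^sub>R v\<close>. Its own increment
    over \<open>[0, h]\<close> is the mixed second difference, so one mean value step in direction
    \<open>u\<close> and one in direction \<open>v\<close> produce the second derivative.\<close>
  let ?\<phi> = "\<lambda>s. f (x + s *\<^sub>R u + h *\<^sub>R v) - f (x + s *\<^sub>R u)"
  have d\<phi>: "(?\<phi> has_derivative (\<lambda>a. a * (D f (x + s *\<^sub>R u + h *\<^sub>R v) u - D f (x + s *\<^sub>R u) u))) (at s)"
    if "0 \<le> s" "s \<le> h" for s
  proof -
    have y: "x + s *\<^sub>R u + h *\<^sub>R v \<in> S" "x + s *\<^sub>R u \<in> S"
      using S[of s h] S[of s 0] that \<open>0 < h\<close> by auto
    have "((\<lambda>s. x + s *\<^sub>R u + h *\<^sub>R v) has_derivative (\<lambda>a. a *\<^sub>R u)) (at s)"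
      by (auto intro!: derivative_eq_intros)
    from has_derivative_compose[OF this df[OF y(1)]]
    have "((\<lambda>s. f (x + s *\<^sub>R u + h *\<^sub>R v)) has_derivative (\<lambda>a. D f (x + s *\<^sub>R u + h *\<^sub>R v) (a *\<^sub>R u))) (at s)" .
    moreover have "((\<lambda>s. x + s *\<^sub>R u) has_derivative (\<lambda>a. a *\<^sub>R u)) (at s)"
      by (auto intro!: derivative_eq_intros)
    from has_derivative_compose[OF this df[OF y(2)]]
    have "((\<lambda>s. f (x + s *\<^sub>R u)) has_derivative (\<lambda>a. D f (x + s *\<^sub>R u) (a *\<^sub>R u))) (at s)" .
    ultimately show ?thesis
      using has_derivative_diff lin[OF y(1)] lin[OF y(2)] by (fastforce simp: right_diff_distrib)
  qed
  obtain s where s: "0 < s" "s < h"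
    "?\<phi> h - ?\<phi> 0 = (h - 0) * (D f (x + s *\<^sub>R u + h *\<^sub>R v) u - D f (x + s *\<^sub>R u) u)"
    using mvt_simple[OF \<open>0 < h\<close>, of ?\<phi>
        "\<lambda>s a. a * (D f (x + s *\<^sub>R u + h *\<^sub>R v) u - D f (x + s *\<^sub>R u) u)"]
      has_derivative_at_withinI[OF d\<phi>] by auto
  let ?\<psi> = "\<lambda>t. D f (x + s *\<^sub>R u + t *\<^sub>R v) u"
  have d\<psi>: "(?\<psi> has_derivative (\<lambda>a. a * D (\<lambda>y. D f y u) (x + s *\<^sub>R u + t *\<^sub>R v) v)) (at t)"
    if "0 \<le> t" "t \<le> h" for t
  proof -
    have y: "x + s *\<^sub>R u + t *\<^sub>R v \<in> S"
      using S[of s t] that s by auto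
    have "((\<lambda>t. x + s *\<^sub>R u + t *\<^sub>R v) has_derivative (\<lambda>a. a *\<^sub>R v)) (at t)"
      by (auto intro!: derivative_eq_intros)
    from has_derivative_compose[OF this ddf[OF y]] show ?thesis
      by (simp add: lin2[OF y])
  qed
  obtain t where t: "0 < t" "t < h"
    "?\<psi> h - ?\<psi> 0 = (h - 0) * D (\<lambda>y. D f y u) (x + s *\<^sub>R u + t *\<^sub>R v) v"
    using mvt_simple[OF \<open>0 < h\<close>, of ?\<psi> "\<lambda>t a. a * D (\<lambda>y. D f y u) (x + s *\<^sub>R u + t *\<^sub>R v) v"]
      has_derivative_at_withinI[OF d\<psi>] by auto
  show thesis
    by (rule that[OF s(1,2) t(1,2)]) (use s(3) t(3) in \<open>simp add: algebra_simps\<close>)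
qed

text \<open>The mixed second difference is unchanged when \<open>u\<close> and \<open>v\<close> are
  swapped, so the two iterated derivatives take a common value at points arbitrarily close to
  \<open>x\<close>; continuity forces them to agree at \<open>x\<close>.\<close>

lemma second_derivative_symmetric_real:
  fixes f :: "'a::euclidean_space \<Rightarrow> real"
  assumes "open S" "Ck_on 2 S f" "x \<in> S"
  shows "D (\<lambda>y. D f y u) x v = D (\<lambda>y. D f y v) x u"
proof (rule ccontr)
  let ?A = "\<lambda>u v y. D (\<lambda>y. D f y u) y v"
  assume neq: "\<not> ?thesis"
  define e where "e = \<bar>?A u v x - ?A v u x\<bar> / 2"
  have e: "0 < e"
    using neq by (simp add: e_def)
  have cont: "continuous_on S (?A u v)" for u v
    using assms(2) by (simp add: numeral_2_eq_2)
  obtain d where d: "0 < d" "\<And>y. dist y x < d \<Longrightarrow> y \<in> S"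
      "\<And>y. dist y x < d \<Longrightarrow> dist (?A u v y) (?A u v x) < e"
      "\<And>y. dist y x < d \<Longrightarrow> dist (?A v u y) (?A v u x) < e"
  proof -
    obtain d1 where "0 < d1" "\<And>y. dist y x < d1 \<Longrightarrow> y \<in> S"
      using assms(1,3) unfolding open_dist by blast
    moreover obtain d2 where "0 < d2" "\<And>y. y \<in> S \<Longrightarrow> dist y x < d2 \<Longrightarrow> dist (?A u v y) (?A u v x) < e"
      using cont[of u v] e assms(3) unfolding continuous_on_iff by blast
    moreover obtain d3 where "0 < d3" "\<And>y. y \<in> S \<Longrightarrow> dist y x < d3 \<Longrightarrow> dist (?A v u y) (?A v u x) < e"
      using cont[of v u] e assms(3) unfolding continuous_on_iff by blast
    ultimately show thesis
      by (intro that[of "min d1 (min d2 d3)"]) auto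
  qed
  \<comment> \<open>Keeps the whole parallelogram spanned by \<open>h *\<^sub>R u\<close> and
    \<open>h *\<^sub>R v\<close> within \<open>d / 2\<close> of \<open>x\<close>; the summand 1
    keeps the denominator positive when both vectors vanish.\<close>
  define h where "h = d / (2 * (1 + norm u + norm v))"
  have pos: "0 < 1 + norm u + norm v"
    by (simp add: add_pos_nonneg)
  have h: "0 < h"
    using d(1) pos by (simp add: h_def)
  have near: "dist (x + s *\<^sub>R u + t *\<^sub>R v) x < d" if "0 \<le> s" "s \<le> h" "0 \<le> t" "t \<le> h" for s t
  proof -
    have "dist (x + s *\<^sub>R u + t *\<^sub>R v) x = norm (s *\<^sub>R u + t *\<^sub>R v)"
      by (simp add: dist_norm)
    also have "\<dots> \<le> s * norm u + t * norm v"
      using that norm_triangle_ineq[of "s *\<^sub>R u" "t *\<^sub>R v"] by simp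
    also have "\<dots> \<le> h * norm u + h * norm v"
      using that by (intro add_mono mult_right_mono) auto
    also have "\<dots> \<le> h * (1 + norm u + norm v)"
      using h by (simp add: algebra_simps)
    also have "\<dots> = d / 2"
      using pos by (simp add: h_def field_simps)
    also have "\<dots> < d"
      using d(1) by simp
    finally show ?thesis .
  qed
  obtain s t where st: "0 < s" "s < h" "0 < t" "t < h"
    "f (x + h *\<^sub>R u + h *\<^sub>R v) - f (x + h *\<^sub>R u) - f (x + h *\<^sub>R v) + f x
      = h * h * ?A u v (x + s *\<^sub>R u + t *\<^sub>R v)"
    by (rule second_derivative_mvt[OF assms(1,2) h d(2)[OF near]])
  have near': "dist (x + s *\<^sub>R v + t *\<^sub>R u) x < d" if "0 \<le> s" "s \<le> h" "0 \<le> t" "t \<le> h" for s t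
    using near[OF that(3,4,1,2)] by (simp add: add.commute add.left_commute)
  obtain s' t' where st': "0 < s'" "s' < h" "0 < t'" "t' < h"
    "f (x + h *\<^sub>R v + h *\<^sub>R u) - f (x + h *\<^sub>R v) - f (x + h *\<^sub>R u) + f x
      = h * h * ?A v u (x + s' *\<^sub>R v + t' *\<^sub>R u)"
    by (rule second_derivative_mvt[OF assms(1,2) h d(2)[OF near']])
  \<comment> \<open>Both sides are the same second difference, read in the two orders.\<close>
  have "h * h * ?A u v (x + s *\<^sub>R u + t *\<^sub>R v) = h * h * ?A v u (x + s' *\<^sub>R v + t' *\<^sub>R u)"
    using st(5) st'(5) by (simp add: algebra_simps)
  then have "?A u v (x + s *\<^sub>R u + t *\<^sub>R v) = ?A v u (x + s' *\<^sub>R v + t' *\<^sub>R u)"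
    using h by simp
  moreover have "dist (?A u v (x + s *\<^sub>R u + t *\<^sub>R v)) (?A u v x) < e"
    using st by (intro d(3) near) auto
  moreover have "dist (?A v u (x + s' *\<^sub>R v + t' *\<^sub>R u)) (?A v u x) < e"
    using st' by (intro d(4) near') auto
  ultimately have "\<bar>?A u v x - ?A v u x\<bar> < 2 * e"
    by (simp add: dist_real_def)
  then show False
    by (simp add: e_def)
qed

text \<open>Taken coordinate by coordinate, since the mean value argument is real-valued.\<close>

lemma second_derivative_symmetric:
  fixes f :: "'a::euclidean_space \<Rightarrow> 'b::euclidean_space"
  assumes "open S" "Ck_on 2 S f" "x \<in> S"
  shows "D (\<lambda>y. D f y u) x v = D (\<lambda>y. D f y v) x u"
proof (rule euclidean_eqI)
  fix b :: 'b assume "b \<in> Basis"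
  let ?f = "\<lambda>y. f y \<bullet> b"
  have C2: "Ck_on (Suc (Suc 0)) S f"
    using assms(2) by (simp only: numeral_2_eq_2)
  have 1: "D ?f y w = D f y w \<bullet> b" if "y \<in> S" for y w
    by (simp only: D_eqI[OF has_derivative_inner_left[OF Ck_on_has_derivative[OF assms(1) C2 that]]])
  have 2: "D (\<lambda>y. D ?f y u) x v = D (\<lambda>y. D f y u) x v \<bullet> b" for u v
  proof -
    have "D (\<lambda>y. D ?f y u) x v = D (\<lambda>y. D f y u \<bullet> b) x v"
      by (simp only: D_cong[OF assms(1,3) 1])
    also have "\<dots> = D (\<lambda>y. D f y u) x v \<bullet> b"
      by (simp only: D_eqI[OF has_derivative_inner_left[OF
            Ck_on_has_derivative[OF assms(1) Ck_on_D[OF C2] assms(3)]]])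
    finally show ?thesis .
  qed
  have "Ck_on 2 S ?f"
    using Ck_on_inner_const assms by blast
  from second_derivative_symmetric_real[OF assms(1) this assms(3), of u v]
  show "D (\<lambda>y. D f y u) x v \<bullet> b = D (\<lambda>y. D f y v) x u \<bullet> b"
    by (simp add: 2)
qed

text \<open>Linearity in the inner direction: unlike the outer one it is not part of being a
  derivative, and comes from differentiating the basis expansion of \<open>D f y u\<close>.\<close>

lemma D_D_expand:
  fixes f :: "'a::euclidean_space \<Rightarrow> 'b::real_normed_vector"
  assumes "open S" "Ck_on 2 S f" "x \<in> S"
  shows "D (\<lambda>y. D f y u) x v = (\<Sum>b\<in>Basis. (u \<bullet> b) *\<^sub>R D (\<lambda>y. D f y b) x v)"
proof -
  have C2: "Ck_on (Suc (Suc 0)) S f"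
    using assms(2) by (simp only: numeral_2_eq_2)
  have exp: "D f y u = (\<Sum>b\<in>Basis. (u \<bullet> b) *\<^sub>R D f y b)" if "y \<in> S" for y
    by (rule linear_euclidean_expand[OF has_derivative_linear[OF Ck_on_has_derivative[OF assms(1) C2 that]]])
  have ddf: "((\<lambda>y. D f y w) has_derivative D (\<lambda>y. D f y w) x) (at x)" for w
    using Ck_on_has_derivative[OF assms(1) Ck_on_D[OF C2] assms(3)] .
  have "((\<lambda>y. \<Sum>b\<in>Basis. (u \<bullet> b) *\<^sub>R D f y b) has_derivative
     (\<lambda>v. \<Sum>b\<in>Basis. (u \<bullet> b) *\<^sub>R D (\<lambda>y. D f y b) x v)) (at x)"
    by (intro has_derivative_sum has_derivative_scaleR_right ddf)
  then have "((\<lambda>y. D f y u) has_derivative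
     (\<lambda>v. \<Sum>b\<in>Basis. (u \<bullet> b) *\<^sub>R D (\<lambda>y. D f y b) x v)) (at x)"
    by (rule has_derivative_transform_within_open[OF _ assms(1,3)]) (simp add: exp[symmetric])
  then show ?thesis
    by (simp only: D_eqI)
qed

text \<open>Used for both the bracket and fields along the immersion: differentiating
  \<open>D f y (g y)\<close> leaves one second-derivative term, which disappears after
  skew-symmetrization, and one term that is \<open>D f x\<close> of a derivative.\<close>

lemma D_D_apply:
  fixes f :: "'a::euclidean_space \<Rightarrow> 'b::real_normed_vector"
  assumes "open S" "Ck_on 2 S f" "x \<in> S" "(g has_derivative g') (at x)"
  shows "((\<lambda>y. D f y (g y)) has_derivative (\<lambda>v. D (\<lambda>y. D f y (g x)) x v + D f x (g' v))) (at x)"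
proof -
  have C2: "Ck_on (Suc (Suc 0)) S f"
    using assms(2) by (simp only: numeral_2_eq_2)
  have ddf: "((\<lambda>y. D f y w) has_derivative D (\<lambda>y. D f y w) x) (at x)" for w
    using Ck_on_has_derivative[OF assms(1) Ck_on_D[OF C2] assms(3)] .
  have exp: "D f y w = (\<Sum>b\<in>Basis. (w \<bullet> b) *\<^sub>R D f y b)" if "y \<in> S" for y w
    by (rule linear_euclidean_expand[OF has_derivative_linear[OF Ck_on_has_derivative[OF assms(1) C2 that]]])
  have "((\<lambda>y. \<Sum>b\<in>Basis. (g y \<bullet> b) *\<^sub>R D f y b) has_derivative
     (\<lambda>v. \<Sum>b\<in>Basis. (g x \<bullet> b) *\<^sub>R D (\<lambda>y. D f y b) x v + (g' v \<bullet> b) *\<^sub>R D f x b)) (at x)"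
    by (intro has_derivative_sum has_derivative_scaleR has_derivative_inner_left assms(4) ddf)
  then have "((\<lambda>y. D f y (g y)) has_derivative
     (\<lambda>v. \<Sum>b\<in>Basis. (g x \<bullet> b) *\<^sub>R D (\<lambda>y. D f y b) x v + (g' v \<bullet> b) *\<^sub>R D f x b)) (at x)"
    by (rule has_derivative_transform_within_open[OF _ assms(1,3)]) (simp add: exp[symmetric])
  moreover have "(\<Sum>b\<in>Basis. (g x \<bullet> b) *\<^sub>R D (\<lambda>y. D f y b) x v + (g' v \<bullet> b) *\<^sub>R D f x b)
      = D (\<lambda>y. D f y (g x)) x v + D f x (g' v)" for v
    by (simp add: sum.distrib D_D_expand[OF assms(1-3), of "g x"] exp[OF assms(3), of "g' v"])
  ultimately show ?thesis
    by simp
qed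

section \<open>The smooth inverse function theorem\<close>

lemma smooth_on_Ck: "smooth_on S f \<Longrightarrow> Ck_on k S f"
  by (simp add: smooth_on_def)

lemma smooth_on_subset: "smooth_on S f \<Longrightarrow> T \<subseteq> S \<Longrightarrow> smooth_on T f"
  by (auto simp: smooth_on_def intro: Ck_on_subset)

lemma smooth_on_cong: "open S \<Longrightarrow> (\<And>x. x \<in> S \<Longrightarrow> f x = g x) \<Longrightarrow> smooth_on S f \<Longrightarrow> smooth_on S g"
  unfolding smooth_on_def using Ck_on_cong by blast

lemma smooth_on_has_derivative:
  "open S \<Longrightarrow> smooth_on S f \<Longrightarrow> x \<in> S \<Longrightarrow> (f has_derivative D f x) (at x)"
  using Ck_on_has_derivative smooth_on_Ck by blast

lemma smooth_on_D_apply: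
  fixes f :: "'a::euclidean_space \<Rightarrow> 'b::real_normed_vector"
  shows "open S \<Longrightarrow> smooth_on S f \<Longrightarrow> smooth_on S g \<Longrightarrow> smooth_on S (\<lambda>x. D f x (g x))"
  unfolding smooth_on_def using Ck_on_D_apply by blast

lemma smooth_on_compose:
  fixes f :: "'b::euclidean_space \<Rightarrow> 'c::real_normed_vector"
  shows "open S \<Longrightarrow> open T \<Longrightarrow> g ` S \<subseteq> T \<Longrightarrow> smooth_on S g \<Longrightarrow> smooth_on T f \<Longrightarrow> smooth_on S (\<lambda>x. f (g x))"
  unfolding smooth_on_def using Ck_on_compose by blast

lemma smooth_on_const: "open S \<Longrightarrow> smooth_on S (\<lambda>x. c)"
  by (simp add: smooth_on_def Ck_on_const)

lemma smooth_on_bounded_linear: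
  "bounded_linear L \<Longrightarrow> open S \<Longrightarrow> smooth_on S f \<Longrightarrow> smooth_on S (\<lambda>x. L (f x))"
  by (simp add: smooth_on_def Ck_on_bounded_linear)

lemma smooth_on_linear:
  fixes L :: "'a::euclidean_space \<Rightarrow> 'b::real_normed_vector"
  shows "linear L \<Longrightarrow> open S \<Longrightarrow> smooth_on S L"
  unfolding linear_conv_bounded_linear smooth_on_def
  using Ck_on_bounded_linear[of L S _ "\<lambda>x. x", OF _ _ Ck_on_ident] by simp

lemma smooth_on_add: "open S \<Longrightarrow> smooth_on S f \<Longrightarrow> smooth_on S g \<Longrightarrow> smooth_on S (\<lambda>x. f x + g x)"
  by (simp add: smooth_on_def Ck_on_add)

lemma smooth_on_scaleR: "open S \<Longrightarrow> smooth_on S f \<Longrightarrow> smooth_on S g \<Longrightarrow> smooth_on S (\<lambda>x. f x *\<^sub>R g x)"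
  by (simp add: smooth_on_def Ck_on_scaleR)

text \<open>The derivative is block triangular with \<open>D h x\<close> twice on the diagonal,
  hence invertible as soon as \<open>D h x\<close> is.\<close>

lemma has_derivative_tangent_map:
  fixes h :: "'a::euclidean_space \<Rightarrow> 'b::real_normed_vector"
  assumes "open S" "Ck_on 2 S h" "x \<in> S"
  shows "((\<lambda>p. (h (fst p), D h (fst p) (snd p))) has_derivative
    (\<lambda>q. (D h x (fst q), D (\<lambda>y. D h y u) x (fst q) + D h x (snd q)))) (at (x, u))"
proof -
  have C2: "Ck_on (Suc (Suc 0)) S h"
    using assms(2) by (simp only: numeral_2_eq_2)
  have dh: "(h has_derivative D h y) (at y)" if "y \<in> S" for y
    using Ck_on_has_derivative[OF assms(1) C2 that] .
  have exp: "D h y w = (\<Sum>b\<in>Basis. (w \<bullet> b) *\<^sub>R D h y b)" if "y \<in> S" for y w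
    by (rule linear_euclidean_expand[OF has_derivative_linear[OF dh[OF that]]])
  have dfst: "(fst has_derivative fst) (at (x, u))" and dsnd: "(snd has_derivative snd) (at (x, u))"
    by (auto intro!: derivative_eq_intros)
  have d1: "((\<lambda>p. h (fst p)) has_derivative (\<lambda>q. D h x (fst q))) (at (x, u))"
    by (rule has_derivative_compose[OF dfst]) (use dh assms(3) in simp)
  have d2: "((\<lambda>p. D h (fst p) b) has_derivative (\<lambda>q. D (\<lambda>y. D h y b) x (fst q))) (at (x, u))" for b
    by (rule has_derivative_compose[OF dfst])
      (use Ck_on_has_derivative[OF assms(1) Ck_on_D[OF C2] assms(3)] in simp)
  have "((\<lambda>p. \<Sum>b\<in>Basis. (snd p \<bullet> b) *\<^sub>R D h (fst p) b) has_derivative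
     (\<lambda>q. \<Sum>b\<in>Basis. (snd (x, u) \<bullet> b) *\<^sub>R D (\<lambda>y. D h y b) x (fst q)
        + (snd q \<bullet> b) *\<^sub>R D h (fst (x, u)) b)) (at (x, u))"
    by (intro has_derivative_sum has_derivative_scaleR has_derivative_inner_left dsnd d2)
  then have "((\<lambda>p. \<Sum>b\<in>Basis. (snd p \<bullet> b) *\<^sub>R D h (fst p) b) has_derivative
     (\<lambda>q. D (\<lambda>y. D h y u) x (fst q) + D h x (snd q))) (at (x, u))"
    by (simp add: sum.distrib D_D_expand[OF assms, of u] exp[OF assms(3), of "snd _"])
  then have "((\<lambda>p. D h (fst p) (snd p)) has_derivative
     (\<lambda>q. D (\<lambda>y. D h y u) x (fst q) + D h x (snd q))) (at (x, u))"
    by (rule has_derivative_transform_within_open[OF _ open_Times[OF assms(1) open_UNIV]])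
      (use assms(3) exp in auto)
  with d1 show ?thesis
    by (rule has_derivative_Pair)
qed

text \<open>Applying the inverse function rule to the tangent map \<open>(x, u) \<mapsto> (h x, D h x u)\<close> shows that
  the derivative of the inverse is again differentiable.\<close>

lemma has_derivative_D_inverse:
  fixes h g :: "'a::euclidean_space \<Rightarrow> 'a"
  assumes "open U" "Ck_on 2 U h" "\<And>x. x \<in> U \<Longrightarrow> g (h x) = x" "x \<in> U"
    and l: "\<And>x u. x \<in> U \<Longrightarrow> D g (h x) (D h x u) = u" and r: "\<And>u. D h x (D g (h x) u) = u"
  shows "((\<lambda>y. D g y v) has_derivative
    (\<lambda>w. - D g (h x) (D (\<lambda>y. D h y (D g (h x) v)) x (D g (h x) w)))) (at (h x))"
proof -
  let ?F = "\<lambda>p. (h (fst p), D h (fst p) (snd p))"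
  let ?F' = "\<lambda>p q. (D h (fst p) (fst q), D (\<lambda>y. D h y (snd p)) (fst p) (fst q) + D h (fst p) (snd q))"
  let ?G = "\<lambda>p. (g (fst p), D g (fst p) (snd p))"
  \<comment> \<open>Chosen so that \<open>?F (x, u) = (h x, v)\<close>, the point at which the
    derivative of \<open>?G\<close> is wanted.\<close>
  define u where "u = D g (h x) v"
  \<comment> \<open>The inverse of the block triangular map: solve the first component for the base
    direction, then substitute into the second.\<close>
  let ?G' = "\<lambda>q. (D g (h x) (fst q), D g (h x) (snd q - D (\<lambda>y. D h y u) x (D g (h x) (fst q))))"
  have "(?G has_derivative (\<lambda>_. ?G') (x, u)) (at (?F (x, u)))"
  proof (rule has_derivative_inverse_on[where S = "U \<times> UNIV" and f = ?F and f' = ?F' and g = ?G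
          and g' = "\<lambda>_. ?G'" and x = "(x, u)"])
    show "open (U \<times> (UNIV :: 'a set))"
      using assms(1) by (intro open_Times) auto
    show "(?F has_derivative ?F' p) (at p)" if "p \<in> U \<times> UNIV" for p
      using has_derivative_tangent_map[OF assms(1,2), of "fst p" "snd p"] that by auto
    show "?G (?F p) = p" if "p \<in> U \<times> UNIV" for p
      using that by (auto simp: assms(3) l)
    show "?F' (x, u) \<circ> ?G' = id"
      by (simp add: fun_eq_iff r)
  qed (use assms(4) in auto)
  then have dG: "(?G has_derivative ?G') (at (h x, v))"
    by (simp add: u_def r)
  have "((\<lambda>y. (y, v)) has_derivative (\<lambda>w. (w, 0))) (at (h x))"
    by (auto intro!: derivative_eq_intros)
  from has_derivative_snd[OF has_derivative_compose[OF this dG]]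
  have "((\<lambda>y. D g y v) has_derivative
    (\<lambda>w. D g (h x) (0 - D (\<lambda>y. D h y u) x (D g (h x) w)))) (at (h x))"
    by simp
  \<comment> \<open>\<open>g\<close> is not assumed differentiable here, so oddness of
    \<open>D g (h x)\<close> is taken from its being a two-sided inverse of the linear map
    \<open>D h x\<close>.\<close>
  moreover have "D g (h x) (- w) = - D g (h x) w" for w
    using has_derivative_linear[OF Ck_on_has_derivative[OF assms(1) _ assms(4)], of 1 h] assms(2)
      l[OF assms(4), of "- D g (h x) w"] r[of w]
    by (metis Ck_on_Suc_imp linear_neg numeral_2_eq_2 One_nat_def)
  ultimately show ?thesis
    by (simp add: u_def)
qed

text \<open>Bootstrapping: \<open>ddg\<close> expresses the derivative of \<open>D g\<close> through
  \<open>D g\<close>, \<open>g\<close> and the smooth second derivative of \<open>h\<close>. If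
  \<open>D g\<close> is \<open>C\<^sup>k\<close> in every direction, then so is \<open>g\<close>,
  hence the right-hand side, hence \<open>D g\<close> is one order better.\<close>

lemma smooth_on_inverse:
  fixes h g :: "'a::euclidean_space \<Rightarrow> 'a"
  assumes hom: "homeomorphism U V h g" and "open U" "open V" "smooth_on U h"
    and dg: "\<And>y. y \<in> V \<Longrightarrow> (g has_derivative D g y) (at y)"
    and l: "\<And>x u. x \<in> U \<Longrightarrow> D g (h x) (D h x u) = u"
    and r: "\<And>x u. x \<in> U \<Longrightarrow> D h x (D g (h x) u) = u"
  shows "smooth_on V g"
proof -
  let ?H = "\<lambda>p q x. D (\<lambda>x. D h x p) x q"
  have C2: "Ck_on 2 U h"
    using assms(4) smooth_on_Ck by blast
  have gV: "g y \<in> U" "h (g y) = y" if "y \<in> V" for y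
    using hom that by (auto simp: homeomorphism_def)
  have ddg: "((\<lambda>y. D g y v) has_derivative (\<lambda>w. - D g y (?H (D g y v) (D g y w) (g y)))) (at y)"
    if "y \<in> V" for y v
    using has_derivative_D_inverse[where g = g and x = "g y" and v = v, OF assms(2) C2 _ _ l r] gV[OF that] hom
    by (simp add: homeomorphism_def)
  have H: "smooth_on U (?H p q)" for p q
    by (intro smooth_on_D_apply smooth_on_const assms(2,4))
  \<comment> \<open>Both arguments of the second derivative will vary with the point, so it is
    reduced to constant basis directions, where \<open>H\<close> applies.\<close>
  have Hexp: "?H p q x = (\<Sum>i\<in>Basis. \<Sum>j\<in>Basis. (p \<bullet> i) *\<^sub>R (q \<bullet> j) *\<^sub>R ?H i j x)" if "x \<in> U" for p q x
  proof -
    have "linear (D (\<lambda>x. D h x i) x)" for i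
      by (rule has_derivative_linear[OF smooth_on_has_derivative[OF assms(2) _ that]])
        (intro smooth_on_D_apply smooth_on_const assms(2,4))
    then have "?H i q x = (\<Sum>j\<in>Basis. (q \<bullet> j) *\<^sub>R ?H i j x)" for i
      by (rule linear_euclidean_expand)
    then show ?thesis
      using D_D_expand[OF assms(2) C2 that, of p q] by (simp add: scaleR_sum_right)
  qed
  have step: "Ck_on k V g" if "\<forall>v. Ck_on k V (\<lambda>y. D g y v)" for k
    using Ck_on_SucI[OF assms(3) dg] that Ck_on_Suc_imp by blast
  have "Ck_on k V (\<lambda>y. D g y v)" for k v
  proof (induction k arbitrary: v)
    case 0
    have "continuous_on V (\<lambda>y. D g y v)"
      using ddg has_derivative_continuous continuous_at_imp_continuous_on by blast
    then show ?case
      by simp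
  next
    case (Suc k)
    have Hg: "Ck_on k V (\<lambda>y. ?H i j (g y))" for i j
      by (rule Ck_on_compose[OF assms(3,2) _ step smooth_on_Ck[OF H]]) (use Suc gV in auto)
    show ?case
    proof (rule Ck_on_SucI[OF assms(3) ddg])
      fix w
      let ?E = "\<lambda>y. \<Sum>i\<in>Basis. \<Sum>j\<in>Basis. (D g y v \<bullet> i) *\<^sub>R (D g y w \<bullet> j) *\<^sub>R ?H i j (g y)"
      have E: "Ck_on k V ?E"
        by (intro Ck_on_sum Ck_on_scaleR Ck_on_inner_const Hg Suc assms(3))
      \<comment> \<open>The outer \<open>D g y\<close> also has a varying argument and is expanded
        once more. The sign moves into the direction \<open>- b\<close>, which the induction
        hypothesis covers as it covers all constant directions.\<close>
      have "Ck_on k V (\<lambda>y. \<Sum>b\<in>Basis. (?E y \<bullet> b) *\<^sub>R D g y (- b))"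
        by (intro Ck_on_sum Ck_on_scaleR Ck_on_inner_const[OF assms(3) E] Suc assms(3))
      then show "Ck_on k V (\<lambda>y. - D g y (?H (D g y v) (D g y w) (g y)))"
      proof (rule Ck_on_cong[OF assms(3), rotated])
        fix y assume y: "y \<in> V"
        have lin: "linear (D g y)"
          using dg[OF y] by (rule has_derivative_linear)
        have "D g y (- ?E y) = (\<Sum>b\<in>Basis. (?E y \<bullet> b) *\<^sub>R D g y (- b))"
          by (subst linear_euclidean_expand[OF lin]) (simp add: linear_neg[OF lin])
        then show "(\<Sum>b\<in>Basis. (?E y \<bullet> b) *\<^sub>R D g y (- b)) = - D g y (?H (D g y v) (D g y w) (g y))"
          using Hexp[OF gV(1)[OF y], of "D g y v" "D g y w"] linear_neg[OF lin] by simp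
      qed
    qed
  qed
  then show ?thesis
    using step by (auto simp: smooth_on_def)
qed

text \<open>The normalization of the derivative at \<open>x0\<close> to the identity makes
  \<open>id_blinfun\<close> the required inverse there. Continuity of the derivative as an operator
  reduces to continuity on each basis vector, the dimension being finite.\<close>

lemma smooth_inverse_function:
  fixes h :: "'a::euclidean_space \<Rightarrow> 'a"
  assumes "open S" "smooth_on S h" "x0 \<in> S" and id: "\<And>v. D h x0 v = v"
  obtains U V g where "open U" "U \<subseteq> S" "x0 \<in> U" "open V" "homeomorphism U V h g" "smooth_on V g"
proof -
  let ?f' = "\<lambda>x. Blinfun (D h x)"
  have dh: "(h has_derivative D h x) (at x)" if "x \<in> S" for x
    using smooth_on_has_derivative[OF assms(1,2) that] .
  have app: "blinfun_apply (?f' x) = D h x" if "x \<in> S" for x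
    using dh[OF that] by (simp add: bounded_linear_Blinfun_apply has_derivative_bounded_linear)
  obtain U V g g' where *: "open U" "U \<subseteq> S" "x0 \<in> U" "open V" "homeomorphism U V h g"
    "\<And>y. y \<in> V \<Longrightarrow> (g has_derivative (g' y)) (at y)"
    "\<And>y. y \<in> V \<Longrightarrow> g' y = inv (blinfun_apply (?f' (g y)))"
    "\<And>y. y \<in> V \<Longrightarrow> bij (blinfun_apply (?f' (g y)))"
  proof (rule inverse_function_theorem[where U = S and f = h and f' = ?f' and invf = id_blinfun])
    show "(h has_derivative blinfun_apply (?f' x)) (at x)" if "x \<in> S" for x
      using dh[OF that] app[OF that] by simp
    show "continuous_on S ?f'"
    proof (rule continuous_on_blinfun_componentwise)
      fix i :: 'a
      have "continuous_on S (\<lambda>x. D h x i)"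
        using smooth_on_Ck[OF assms(2), of 1] by simp
      then show "continuous_on S (\<lambda>x. blinfun_apply (?f' x) i)"
        by (rule continuous_on_eq) (simp add: app)
    qed
    show "id_blinfun o\<^sub>L ?f' x0 = id_blinfun"
      by (rule blinfun_eqI) (simp add: app[OF assms(3)] id)
  qed (use assms in auto)
  have g: "g (h x) = x" "h x \<in> V" "x \<in> S" if "x \<in> U" for x
    using *(2,5) that by (auto simp: homeomorphism_def)
  have Dg: "D g (h x) = inv (D h x)" "bij (D h x)" if "x \<in> U" for x
    using D_eqI[OF *(6)[OF g(2)[OF that]]] *(7,8)[OF g(2)[OF that]] app[OF g(3)[OF that]]
    by (simp_all add: g(1)[OF that])
  have "smooth_on V g"
  proof (rule smooth_on_inverse[OF *(5,1,4)])
    show "smooth_on U h"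
      using assms(2) *(2) smooth_on_subset by blast
    show "(g has_derivative D g y) (at y)" if "y \<in> V" for y
      using *(6)[OF that] D_eqI by metis
    show "D g (h x) (D h x u) = u" "D h x (D g (h x) u) = u" if "x \<in> U" for x u
      using Dg[OF that] by (simp_all add: bij_is_inj bij_is_surj surj_f_inv_f)
  qed
  then show thesis
    using * that by blast
qed

text \<open>Composing the immersion with a linear left inverse \<open>L\<close> of its derivative gives a local
  diffeomorphism \<open>h\<close>, and \<open>G \<circ> h\<^sup>-\<^sup>1 \<circ> L\<close> is the extension.\<close>

lemma smooth_extension_along_immersion:
  fixes F :: "'b::euclidean_space \<Rightarrow> 'a::euclidean_space" and G :: "'b \<Rightarrow> 'c::real_normed_vector"
  assumes "open S" "smooth_on S F" "smooth_on S G" "x0 \<in> S" "inj (D F x0)"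
  obtains W T G' where "open W" "x0 \<in> W" "W \<subseteq> S" "open T" "F ` W \<subseteq> T" "smooth_on T G'"
    "\<And>x. x \<in> W \<Longrightarrow> G' (F x) = G x"
proof -
  have dF: "(F has_derivative D F x0) (at x0)"
    using smooth_on_has_derivative[OF assms(1,2,4)] .
  obtain L where L: "linear L" "L \<circ> D F x0 = id"
    using linear_injective_left_inverse[OF has_derivative_linear[OF dF] assms(5)] by blast
  then have bL: "bounded_linear L"
    by (simp add: linear_conv_bounded_linear)
  let ?h = "\<lambda>x. L (F x)"
  have "D ?h x0 v = L (D F x0 v)" for v
    using D_eqI[OF bounded_linear.has_derivative[OF bL dF]] by simp
  then have "D ?h x0 v = v" for v
    using L(2) by (simp add: fun_eq_iff)
  moreover have "smooth_on S ?h"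
    by (rule smooth_on_bounded_linear[OF bL assms(1,2)])
  ultimately obtain U V g where *: "open U" "U \<subseteq> S" "x0 \<in> U" "open V" "homeomorphism U V ?h g" "smooth_on V g"
    using smooth_inverse_function[OF assms(1) _ assms(4), of ?h] by blast
  have oL: "open (L -` V)"
    using *(4) bL linear_continuous_on open_vimage by blast
  \<comment> \<open>On \<open>U\<close> the map \<open>g\<close> undoes \<open>?h\<close>, so
    \<open>g (L (F x)) = x\<close> and the extension returns \<open>G x\<close> at
    \<open>F x\<close>.\<close>
  show thesis
  proof (rule that[of U "L -` V" "\<lambda>y. G (g (L y))"])
    have "smooth_on V (\<lambda>y. G (g y))"
      by (rule smooth_on_compose[OF *(4,1) _ *(6) smooth_on_subset[OF assms(3) *(2)]])
        (use *(5) in \<open>auto simp: homeomorphism_def\<close>)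
    then show "smooth_on (L -` V) (\<lambda>y. G (g (L y)))"
      by (rule smooth_on_compose[OF oL *(4) _ smooth_on_linear[OF L(1) oL], rotated]) auto
  qed (use * oL in \<open>auto simp: homeomorphism_def\<close>)
qed

section \<open>Charts\<close>

abbreviation chart_dom :: "('m, 'a) atlas \<Rightarrow> 'm \<Rightarrow> 'm set" where
  "chart_dom A p \<equiv> fst (chart_at A p)"

lemma chart_at_mem:
  assumes "smooth_manifold A"
  shows "(chart_dom A p, coord A p) \<in> A" "p \<in> chart_dom A p"
proof -
  have "p \<in> (\<Union>(U, \<phi>)\<in>A. U)"
    using assms by (simp add: smooth_manifold_def)
  then have "\<exists>c. c \<in> A \<and> p \<in> fst c"
    by force
  from someI_ex[OF this] show "(chart_dom A p, coord A p) \<in> A" "p \<in> chart_dom A p"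
    by (simp_all add: chart_at_def coord_def)
qed

lemma chart_open:
  assumes "smooth_manifold A" "(U, \<phi>) \<in> A"
  shows "open U"
  using assms by (auto simp: smooth_manifold_def)

lemma chart_homeomorphism:
  assumes "smooth_manifold A" "(U, \<phi>) \<in> A"
  shows "homeomorphism U (\<phi> ` U) \<phi> (inv_into U \<phi>)" "open (\<phi> ` U)"
  using assms by (auto simp: smooth_manifold_def)

lemma chart_inv:
  assumes "smooth_manifold A" "(U, \<phi>) \<in> A" "q \<in> U"
  shows "inv_into U \<phi> (\<phi> q) = q"
  using chart_homeomorphism(1)[OF assms(1,2)] assms(3) by (simp add: homeomorphism_def)

lemma chart_image_open:
  assumes "smooth_manifold A" "(U, \<phi>) \<in> A" "open S" "S \<subseteq> U"
  shows "open (\<phi> ` S)"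
proof -
  have "openin (top_of_set (\<phi> ` U)) (\<phi> ` S)"
    by (rule homeomorphism_imp_open_map[OF chart_homeomorphism(1)[OF assms(1,2)]])
      (rule open_subset[OF assms(4,3)])
  then show ?thesis
    using openin_open_trans chart_homeomorphism(2)[OF assms(1,2)] by blast
qed

lemma chart_vimage_open:
  assumes "smooth_manifold A" "(U, \<phi>) \<in> A" "open T"
  shows "open (U \<inter> \<phi> -` T)"
proof (rule continuous_open_preimage[OF _ chart_open[OF assms(1,2)] assms(3)])
  show "continuous_on U \<phi>"
    using chart_homeomorphism(1)[OF assms(1,2)] by (simp add: homeomorphism_def)
qed

lemma smooth_transition:
  assumes "smooth_manifold A" "(U, \<phi>) \<in> A" "(V, \<psi>) \<in> A"
  shows "smooth_on (\<phi> ` (U \<inter> V)) (\<psi> \<circ> inv_into U \<phi>)" "open (\<phi> ` (U \<inter> V))"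
proof -
  have "\<forall>(U, \<phi>)\<in>A. \<forall>(V, \<psi>)\<in>A. smooth_on (\<phi> ` (U \<inter> V)) (\<psi> \<circ> inv_into U \<phi>)"
    using assms(1) unfolding smooth_manifold_def by (elim conjE)
  from bspec[OF bspec[OF this assms(2), unfolded prod.case] assms(3), unfolded prod.case]
  show "smooth_on (\<phi> ` (U \<inter> V)) (\<psi> \<circ> inv_into U \<phi>)" .
  show "open (\<phi> ` (U \<inter> V))"
    by (rule chart_image_open[OF assms(1,2) open_Int[OF chart_open[OF assms(1,2)] chart_open[OF assms(1,3)]]]) simp
qed

lemma transition_has_derivative:
  assumes "smooth_manifold A" "(U, \<phi>) \<in> A" "(V, \<psi>) \<in> A" "q \<in> U" "q \<in> V"
  shows "((\<psi> \<circ> inv_into U \<phi>) has_derivative D (\<psi> \<circ> inv_into U \<phi>) (\<phi> q)) (at (\<phi> q))"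
  by (rule smooth_on_has_derivative[OF smooth_transition(2,1)[OF assms(1-3)]]) (use assms(4,5) in blast)

lemma change_of_chart:
  assumes "smooth_manifold A" "(U, \<phi>) \<in> A" "(V, \<psi>) \<in> A" "q \<in> U" "q \<in> V"
    and "((f \<circ> inv_into U \<phi>) has_derivative F) (at (\<phi> q))"
  shows "((f \<circ> inv_into V \<psi>) has_derivative (\<lambda>v. F (D (\<phi> \<circ> inv_into V \<psi>) (\<psi> q) v))) (at (\<psi> q))"
proof -
  have eq: "(\<phi> \<circ> inv_into V \<psi>) (\<psi> q) = \<phi> q"
    using chart_inv[OF assms(1,3,5)] by simp
  have "((\<lambda>x. (f \<circ> inv_into U \<phi>) ((\<phi> \<circ> inv_into V \<psi>) x)) has_derivative
      (\<lambda>v. F (D (\<phi> \<circ> inv_into V \<psi>) (\<psi> q) v))) (at (\<psi> q))"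
    by (rule has_derivative_compose[OF transition_has_derivative[OF assms(1,3,2,5,4)]])
      (use assms(6) in \<open>simp only: eq\<close>)
  then show ?thesis
  proof (rule has_derivative_transform_within_open)
    show "open (\<psi> ` (V \<inter> U))" "\<psi> q \<in> \<psi> ` (V \<inter> U)"
      using smooth_transition(2)[OF assms(1,3,2)] assms(4,5) by auto
    show "(f \<circ> inv_into U \<phi>) ((\<phi> \<circ> inv_into V \<psi>) x) = (f \<circ> inv_into V \<psi>) x"
      if "x \<in> \<psi> ` (V \<inter> U)" for x
      using that chart_inv[OF assms(1)] assms(2,3) by auto
  qed
qed

text \<open>By the chain rule for the transition map, \<open>v(f)\<close> may be computed in any
  chart around \<open>q\<close>, with \<open>vec_deriv A q v \<phi>\<close> as the components of
  \<open>v\<close>. This removes the dependence on the chosen chart.\<close>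

lemma vec_deriv_eq:
  assumes "smooth_manifold A" "(U, \<phi>) \<in> A" "q \<in> U"
    and "((f \<circ> inv_into U \<phi>) has_derivative F) (at (\<phi> q))"
  shows "vec_deriv A q v f = F (vec_deriv A q v \<phi>)"
  using D_eqI[OF change_of_chart[OF assms(1,2) chart_at_mem(1)[OF assms(1)] assms(3)
        chart_at_mem(2)[OF assms(1)] assms(4)]]
  by (simp add: vec_deriv_def coord_inv_def coord_def)

lemma vec_deriv_coord:
  assumes "smooth_manifold A"
  shows "vec_deriv A p v (coord A p) = v"
proof -
  have "D (coord A p \<circ> coord_inv A p) (coord A p p) = D (\<lambda>x. x) (coord A p p)"
  proof (rule D_cong)
    show "open (coord A p ` chart_dom A p)"
      using chart_homeomorphism(2)[OF assms chart_at_mem(1)[OF assms]] .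
    show "coord A p p \<in> coord A p ` chart_dom A p"
      using chart_at_mem(2)[OF assms] by blast
    show "(coord A p \<circ> coord_inv A p) y = y" if "y \<in> coord A p ` chart_dom A p" for y
      using f_inv_into_f[OF that] by (simp add: coord_inv_def coord_def)
  qed
  then show ?thesis
    by (simp add: vec_deriv_def)
qed

lemma vec_deriv_chart_left_inverse:
  assumes "smooth_manifold A" "(U, \<phi>) \<in> A" "q \<in> U"
  shows "D (coord A q \<circ> inv_into U \<phi>) (\<phi> q) (vec_deriv A q v \<phi>) = v"
  using vec_deriv_eq[OF assms transition_has_derivative[OF assms(1,2) chart_at_mem(1)[OF assms(1)]
        assms(3) chart_at_mem(2)[OF assms(1)]], of v] vec_deriv_coord[OF assms(1), of q v]
  by simp

lemma vec_deriv_chart_inject: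
  assumes "smooth_manifold A" "(U, \<phi>) \<in> A" "q \<in> U" "vec_deriv A q v \<phi> = vec_deriv A q w \<phi>"
  shows "v = w"
  using vec_deriv_chart_left_inverse[OF assms(1-3)] assms(4) by metis

lemma linear_vec_deriv_chart:
  assumes "smooth_manifold A" "(U, \<phi>) \<in> A" "q \<in> U"
  shows "linear (\<lambda>v. vec_deriv A q v \<phi>)"
  using has_derivative_linear[OF transition_has_derivative[OF assms(1) chart_at_mem(1)[OF assms(1)]
        assms(2) chart_at_mem(2)[OF assms(1)] assms(3)]]
  by (simp add: vec_deriv_def coord_inv_def coord_def)

text \<open>Both maps are endomorphisms of the model space, so the left inverse found above is
  two-sided.\<close>

lemma vec_deriv_chart_right_inverse:
  assumes "smooth_manifold A" "(U, \<phi>) \<in> A" "q \<in> U"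
  shows "vec_deriv A q (D (coord A q \<circ> inv_into U \<phi>) (\<phi> q) u) \<phi> = u"
proof -
  have "linear (D (coord A q \<circ> inv_into U \<phi>) (\<phi> q))"
    using has_derivative_linear[OF transition_has_derivative[OF assms(1,2) chart_at_mem(1)[OF assms(1)]
        assms(3) chart_at_mem(2)[OF assms(1)]]] .
  from linear_inverse_left[OF this linear_vec_deriv_chart[OF assms]]
  have "(\<lambda>v. vec_deriv A q v \<phi>) \<circ> D (coord A q \<circ> inv_into U \<phi>) (\<phi> q) = id"
    using vec_deriv_chart_left_inverse[OF assms] by (simp add: fun_eq_iff)
  then show ?thesis
    by (simp add: fun_eq_iff)
qed

section \<open>Vector fields in charts\<close>

lemma smooth_fun_chartD:
  "smooth_fun A S f \<Longrightarrow> (U, \<phi>) \<in> A \<Longrightarrow> smooth_on (\<phi> ` (S \<inter> U)) (f \<circ> inv_into U \<phi>)"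
  by (auto simp: smooth_fun_def)

lemma smooth_vf_chartD:
  "smooth_vf A S X \<Longrightarrow> (U, \<phi>) \<in> A \<Longrightarrow>
    smooth_on (\<phi> ` (S \<inter> U)) ((\<lambda>p. vec_deriv A p (X p) \<phi>) \<circ> inv_into U \<phi>)"
  by (auto simp: smooth_vf_def)

lemma smooth_vf_subset:
  assumes "smooth_vf A S X" "T \<subseteq> S"
  shows "smooth_vf A T X"
  unfolding smooth_vf_def
proof clarify
  fix U \<phi> assume "(U, \<phi>) \<in> A"
  from smooth_vf_chartD[OF assms(1) this]
  show "smooth_on (\<phi> ` (T \<inter> U)) ((\<lambda>p. vec_deriv A p (X p) \<phi>) \<circ> inv_into U \<phi>)"
    by (rule smooth_on_subset) (use assms(2) in auto)
qed

text \<open>The vector field whose components in the chart \<open>(U, \<phi>)\<close> are given by \<open>G\<close>.\<close>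

definition chart_field ::
  "('m, 'a::euclidean_space) atlas \<Rightarrow> 'm set \<Rightarrow> ('m \<Rightarrow> 'a) \<Rightarrow> ('a \<Rightarrow> 'a) \<Rightarrow> 'm \<Rightarrow> 'a" where
  "chart_field A U \<phi> G q = D (coord A q \<circ> inv_into U \<phi>) (\<phi> q) (G (\<phi> q))"

lemma vec_deriv_chart_field:
  assumes "smooth_manifold A" "(U, \<phi>) \<in> A" "q \<in> U"
  shows "vec_deriv A q (chart_field A U \<phi> G q) \<phi> = G (\<phi> q)"
  using vec_deriv_chart_right_inverse[OF assms] by (simp add: chart_field_def)

text \<open>One chart containing \<open>S\<close> suffices: every other representative differs by a
  smooth transition map.\<close>

lemma smooth_fun_chartI:
  assumes "smooth_manifold A" "(U, \<phi>) \<in> A" "open S" "S \<subseteq> U" "smooth_on (\<phi> ` S) (f \<circ> inv_into U \<phi>)"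
  shows "smooth_fun A S f"
  unfolding smooth_fun_def
proof clarify
  fix V \<psi> assume V: "(V, \<psi>) \<in> A"
  have o: "open (\<psi> ` (S \<inter> V))"
    by (rule chart_image_open[OF assms(1) V open_Int[OF assms(3) chart_open[OF assms(1) V]]]) simp
  have "smooth_on (\<psi> ` (S \<inter> V)) (\<lambda>x. (f \<circ> inv_into U \<phi>) ((\<phi> \<circ> inv_into V \<psi>) x))"
  proof (rule smooth_on_compose[OF o chart_image_open[OF assms(1-4)] _ _ assms(5)])
    show "smooth_on (\<psi> ` (S \<inter> V)) (\<phi> \<circ> inv_into V \<psi>)"
      using smooth_transition(1)[OF assms(1) V assms(2)] by (rule smooth_on_subset) (use assms(4) in auto)
    show "(\<phi> \<circ> inv_into V \<psi>) ` \<psi> ` (S \<inter> V) \<subseteq> \<phi> ` S"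
      using chart_inv[OF assms(1) V] by auto
  qed
  then show "smooth_on (\<psi> ` (S \<inter> V)) (f \<circ> inv_into V \<psi>)"
    by (rule smooth_on_cong[OF o, rotated])
      (use chart_inv[OF assms(1) V] chart_inv[OF assms(1,2)] assms(4) in auto)
qed

lemma smooth_vf_chart_field:
  assumes "smooth_manifold A" "(U, \<phi>) \<in> A" "open S" "S \<subseteq> U" "smooth_on (\<phi> ` S) G"
  shows "smooth_vf A S (chart_field A U \<phi> G)"
  unfolding smooth_vf_def
proof clarify
  fix V \<psi> assume V: "(V, \<psi>) \<in> A"
  have o: "open (\<psi> ` (S \<inter> V))"
    by (rule chart_image_open[OF assms(1) V open_Int[OF assms(3) chart_open[OF assms(1) V]]]) simp
  have o': "open (\<phi> ` (S \<inter> V))"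
    by (rule chart_image_open[OF assms(1,2) open_Int[OF assms(3) chart_open[OF assms(1) V]]])
      (use assms(4) in auto)
  \<comment> \<open>The transformation rule for components, still written in the coordinates of
    \<open>\<phi>\<close>; composing with the transition map expresses it in those of
    \<open>\<psi>\<close>.\<close>
  let ?K = "\<lambda>y. D (\<psi> \<circ> inv_into U \<phi>) y (G y)"
  have K: "smooth_on (\<phi> ` (S \<inter> V)) ?K"
  proof (rule smooth_on_D_apply[OF o'])
    show "smooth_on (\<phi> ` (S \<inter> V)) (\<psi> \<circ> inv_into U \<phi>)"
      using smooth_transition(1)[OF assms(1,2) V] by (rule smooth_on_subset) (use assms(4) in auto)
    show "smooth_on (\<phi> ` (S \<inter> V)) G"
      using assms(5) by (rule smooth_on_subset) auto
  qed
  have "smooth_on (\<psi> ` (S \<inter> V)) (\<lambda>x. ?K ((\<phi> \<circ> inv_into V \<psi>) x))"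
  proof (rule smooth_on_compose[OF o o' _ _ K])
    show "smooth_on (\<psi> ` (S \<inter> V)) (\<phi> \<circ> inv_into V \<psi>)"
      using smooth_transition(1)[OF assms(1) V assms(2)] by (rule smooth_on_subset) (use assms(4) in auto)
    show "(\<phi> \<circ> inv_into V \<psi>) ` \<psi> ` (S \<inter> V) \<subseteq> \<phi> ` (S \<inter> V)"
      using chart_inv[OF assms(1) V] by auto
  qed
  then show "smooth_on (\<psi> ` (S \<inter> V)) ((\<lambda>p. vec_deriv A p (chart_field A U \<phi> G p) \<psi>) \<circ> inv_into V \<psi>)"
  proof (rule smooth_on_cong[OF o, rotated], clarify)
    fix q assume q: "q \<in> S" "q \<in> V"
    then have qU: "q \<in> U"
      using assms(4) by blast
    have "vec_deriv A q (chart_field A U \<phi> G q) \<psi> = ?K (\<phi> q)"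
      using vec_deriv_eq[OF assms(1,2) qU transition_has_derivative[OF assms(1,2) V qU q(2)]]
        vec_deriv_chart_field[OF assms(1,2) qU] by simp
    then show "?K ((\<phi> \<circ> inv_into V \<psi>) (\<psi> q)) =
        ((\<lambda>p. vec_deriv A p (chart_field A U \<phi> G p) \<psi>) \<circ> inv_into V \<psi>) (\<psi> q)"
      using chart_inv[OF assms(1) V q(2)] by simp
  qed
qed

text \<open>The field read in the single chart chosen at \<open>p\<close>, as a map between
  Euclidean spaces. This is what can be differentiated, since \<open>X q\<close> refers to the
  unrelated chart chosen at \<open>q\<close>.\<close>

definition components :: "('m, 'a::euclidean_space) atlas \<Rightarrow> 'm \<Rightarrow> ('m \<Rightarrow> 'a) \<Rightarrow> 'a \<Rightarrow> 'a" where
  "components A p X x = vec_deriv A (coord_inv A p x) (X (coord_inv A p x)) (coord A p)"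

lemma coord_inv_eq: "coord_inv A p = inv_into (chart_dom A p) (coord A p)"
  by (simp add: coord_inv_def coord_def)

lemma coord_inv_coord:
  assumes "smooth_manifold A" "q \<in> chart_dom A p"
  shows "coord_inv A p (coord A p q) = q"
  using chart_inv[OF assms(1) chart_at_mem(1)[OF assms(1)] assms(2)] by (simp add: coord_inv_eq)

lemma open_coord_image:
  assumes "smooth_manifold A" "open S"
  shows "open (coord A p ` (S \<inter> chart_dom A p))"
  by (rule chart_image_open[OF assms(1) chart_at_mem(1)[OF assms(1)]
        open_Int[OF assms(2) chart_open[OF assms(1) chart_at_mem(1)[OF assms(1)]]]]) simp

lemma smooth_on_components:
  assumes "smooth_manifold A" "smooth_vf A S X"
  shows "smooth_on (coord A p ` (S \<inter> chart_dom A p)) (components A p X)"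
  using smooth_vf_chartD[OF assms(2) chart_at_mem(1)[OF assms(1), of p]]
  by (simp add: components_def[abs_def] coord_inv_eq comp_def)

lemma components_coord:
  assumes "smooth_manifold A"
  shows "components A p X (coord A p p) = X p"
  using assms by (simp add: components_def coord_inv_coord chart_at_mem vec_deriv_coord)

lemma vec_deriv_eq_D_components:
  assumes "smooth_manifold A" "q \<in> chart_dom A p"
    and "((f \<circ> coord_inv A p) has_derivative F) (at (coord A p q))"
  shows "vec_deriv A q (X q) f = F (components A p X (coord A p q))"
  using vec_deriv_eq[OF assms(1) chart_at_mem(1)[OF assms(1)] assms(2)] assms(3)
  by (simp add: components_def coord_inv_eq[symmetric] coord_inv_coord[OF assms(1,2)])

text \<open>Uniqueness in the definite description: testing with the coordinate functions of the
  chart at \<open>p\<close> recovers every component of the vector.\<close>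

lemma lie_bracket_eqI:
  assumes M: "smooth_manifold A"
    and w: "\<And>S f :: _ \<Rightarrow> real. open S \<Longrightarrow> p \<in> S \<Longrightarrow> smooth_fun A S f \<Longrightarrow>
        vec_deriv A p w f = vec_deriv A p (X p) (\<lambda>q. vec_deriv A q (Y q) f) -
          vec_deriv A p (Y p) (\<lambda>q. vec_deriv A q (X q) f)"
  shows "lie_bracket A X Y p = w"
  unfolding lie_bracket_def
proof (rule the_equality)
  let ?U = "chart_dom A p"
  have oU: "open ?U"
    using chart_open[OF M chart_at_mem(1)[OF M]] .
  fix w' assume w': "\<forall>S. \<forall>f :: _ \<Rightarrow> real. open S \<longrightarrow> p \<in> S \<longrightarrow> smooth_fun A S f \<longrightarrow>
        vec_deriv A p w' f = vec_deriv A p (X p) (\<lambda>q. vec_deriv A q (Y q) f) -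
          vec_deriv A p (Y p) (\<lambda>q. vec_deriv A q (X q) f)"
  show "w' = w"
  proof (rule euclidean_eqI)
    fix i :: 'b assume "i \<in> Basis"
    let ?f = "\<lambda>q. coord A p q \<bullet> i"
    have eq: "(?f \<circ> coord_inv A p) x = x \<bullet> i" if "x \<in> coord A p ` ?U" for x
      using f_inv_into_f[OF that] by (simp add: coord_inv_eq)
    have o: "open (coord A p ` ?U)"
      using open_coord_image[OF M oU, of p] by simp
    have "smooth_on (coord A p ` ?U) (\<lambda>x. x \<bullet> i)"
      by (rule smooth_on_linear[OF bounded_linear.linear[OF bounded_linear_inner_left] o])
    then have "smooth_on (coord A p ` ?U) (?f \<circ> coord_inv A p)"
      by (rule smooth_on_cong[OF o, rotated]) (simp only: eq)
    then have f: "smooth_fun A ?U ?f"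
      using smooth_fun_chartI[OF M chart_at_mem(1)[OF M] oU order_refl] by (simp add: coord_inv_eq)
    have "vec_deriv A p w' ?f = vec_deriv A p w ?f"
      using w[OF oU chart_at_mem(2)[OF M] f] w'[rule_format, OF oU chart_at_mem(2)[OF M] f] by simp
    moreover have "vec_deriv A p v ?f = v \<bullet> i" for v
    proof -
      have "((\<lambda>x. x \<bullet> i) has_derivative (\<lambda>x. x \<bullet> i)) (at (coord A p p))"
        by (auto intro!: derivative_eq_intros)
      then have "((?f \<circ> coord_inv A p) has_derivative (\<lambda>x. x \<bullet> i)) (at (coord A p p))"
        by (rule has_derivative_transform_within_open[OF _ o])
          (use chart_at_mem(2)[OF M] eq in auto)
      then have "D (?f \<circ> coord_inv A p) (coord A p p) = (\<lambda>x. x \<bullet> i)"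
        by (rule D_eqI)
      then show ?thesis
        by (simp add: vec_deriv_def)
    qed
    ultimately show "w' \<bullet> i = w \<bullet> i"
      by simp
  qed
qed (use w in blast)

text \<open>Each iterated derivative of \<open>f\<close> contributes a second-derivative term of its
  local representative; symmetry cancels these two, and what is left is a first derivative of
  \<open>f\<close>.\<close>

lemma lie_bracket_components:
  assumes M: "smooth_manifold A" and S: "open S" "p \<in> S" and X: "smooth_vf A S X" and Y: "smooth_vf A S Y"
  shows "lie_bracket A X Y p =
    D (components A p Y) (coord A p p) (X p) - D (components A p X) (coord A p p) (Y p)"
proof (rule lie_bracket_eqI[OF M])
  fix T and f :: "_ \<Rightarrow> real" assume T: "open T" "p \<in> T" and f: "smooth_fun A T f"
  let ?U = "chart_dom A p"
  let ?W = "coord A p ` (S \<inter> T \<inter> ?U)"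
  let ?x = "coord A p p"
  let ?f = "f \<circ> coord_inv A p"
  have oW: "open ?W" and x: "?x \<in> ?W"
    using open_coord_image[OF M open_Int[OF S(1) T(1)]] S T chart_at_mem(2)[OF M] by auto
  have f': "smooth_on ?W ?f"
    using smooth_fun_chartD[OF f chart_at_mem(1)[OF M, of p]] unfolding coord_inv_eq
    by (rule smooth_on_subset) auto
  have C2: "Ck_on 2 ?W ?f"
    using smooth_on_Ck[OF f'] .
  have df: "(?f has_derivative D ?f y) (at y)" if "y \<in> ?W" for y
    using smooth_on_has_derivative[OF oW f' that] .
  have key: "vec_deriv A p v (\<lambda>q. vec_deriv A q (Z q) f) =
      D (\<lambda>y. D ?f y (Z p)) ?x v + D ?f ?x (D (components A p Z) ?x v)"
    if Z: "smooth_vf A S Z" for Z v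
  proof -
    have "smooth_on ?W (components A p Z)"
      using smooth_on_components[OF M Z] by (rule smooth_on_subset) auto
    from D_D_apply[OF oW C2 x smooth_on_has_derivative[OF oW this x]]
    have "((\<lambda>y. D ?f y (components A p Z y)) has_derivative
       (\<lambda>v. D (\<lambda>y. D ?f y (Z p)) ?x v + D ?f ?x (D (components A p Z) ?x v))) (at ?x)"
      by (simp add: components_coord[OF M])
    then have "(((\<lambda>q. vec_deriv A q (Z q) f) \<circ> coord_inv A p) has_derivative
       (\<lambda>v. D (\<lambda>y. D ?f y (Z p)) ?x v + D ?f ?x (D (components A p Z) ?x v))) (at ?x)"
    proof (rule has_derivative_transform_within_open[OF _ oW x])
      fix y assume y: "y \<in> ?W"
      then obtain q where q: "q \<in> ?U" "y = coord A p q"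
        by blast
      show "D ?f y (components A p Z y) = ((\<lambda>q. vec_deriv A q (Z q) f) \<circ> coord_inv A p) y"
        using vec_deriv_eq_D_components[OF M q(1), of f "D ?f y" Z] df[OF y] q
        by (simp add: coord_inv_coord[OF M])
    qed
    then show ?thesis
      unfolding vec_deriv_def[of A p] by (simp only: D_eqI)
  qed
  have "vec_deriv A p (D (components A p Y) ?x (X p) - D (components A p X) ?x (Y p)) f =
      D ?f ?x (D (components A p Y) ?x (X p)) - D ?f ?x (D (components A p X) ?x (Y p))"
    using linear_diff[OF has_derivative_linear[OF df[OF x]]] by (simp add: vec_deriv_def)
  also have "\<dots> = vec_deriv A p (X p) (\<lambda>q. vec_deriv A q (Y q) f) -
          vec_deriv A p (Y p) (\<lambda>q. vec_deriv A q (X q) f)"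
    using second_derivative_symmetric_real[OF oW C2 x, of "X p" "Y p"] by (simp add: key X Y)
  finally show "vec_deriv A p (D (components A p Y) ?x (X p) - D (components A p X) ?x (Y p)) f =
      vec_deriv A p (X p) (\<lambda>q. vec_deriv A q (Y q) f) - vec_deriv A p (Y p) (\<lambda>q. vec_deriv A q (X q) f)" .
qed

section \<open>Smooth fields as a module over the smooth functions\<close>

lemma smooth_vfI:
  assumes "smooth_manifold A" "open S"
    and "\<And>U \<phi>. (U, \<phi>) \<in> A \<Longrightarrow> smooth_on (\<phi> ` (S \<inter> U)) (G U \<phi>)"
    and "\<And>U \<phi> q. (U, \<phi>) \<in> A \<Longrightarrow> q \<in> S \<Longrightarrow> q \<in> U \<Longrightarrow> vec_deriv A q (X q) \<phi> = G U \<phi> (\<phi> q)"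
  shows "smooth_vf A S X"
  unfolding smooth_vf_def
proof clarify
  fix U \<phi> assume U: "(U, \<phi>) \<in> A"
  have o: "open (\<phi> ` (S \<inter> U))"
    by (rule chart_image_open[OF assms(1) U open_Int[OF assms(2) chart_open[OF assms(1) U]]]) simp
  show "smooth_on (\<phi> ` (S \<inter> U)) ((\<lambda>p. vec_deriv A p (X p) \<phi>) \<circ> inv_into U \<phi>)"
    by (rule smooth_on_cong[OF o _ assms(3)[OF U]])
      (use chart_inv[OF assms(1) U] assms(4)[OF U] in auto)
qed

lemma smooth_vf_zero:
  assumes "smooth_manifold A" "open S"
  shows "smooth_vf A S (\<lambda>q. 0)"
proof (rule smooth_vfI[where G = "\<lambda>_ _ _. 0", OF assms])
  fix U \<phi> assume U: "(U, \<phi>) \<in> A"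
  show "smooth_on (\<phi> ` (S \<inter> U)) (\<lambda>_. 0)"
    by (rule smooth_on_const)
      (rule chart_image_open[OF assms(1) U open_Int[OF assms(2) chart_open[OF assms(1) U]]], simp)
  show "vec_deriv A q 0 \<phi> = 0" if "q \<in> U" for q
    using linear_0[OF linear_vec_deriv_chart[OF assms(1) U that]] .
qed

lemma smooth_vf_add:
  assumes "smooth_manifold A" "open S" "smooth_vf A S X" "smooth_vf A S Y"
  shows "smooth_vf A S (\<lambda>q. X q + Y q)"
proof (rule smooth_vfI[OF assms(1,2)])
  fix U \<phi> assume U: "(U, \<phi>) \<in> A"
  show "smooth_on (\<phi> ` (S \<inter> U)) (\<lambda>x. ((\<lambda>p. vec_deriv A p (X p) \<phi>) \<circ> inv_into U \<phi>) x
      + ((\<lambda>p. vec_deriv A p (Y p) \<phi>) \<circ> inv_into U \<phi>) x)"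
    by (rule smooth_on_add[OF _ smooth_vf_chartD[OF assms(3) U] smooth_vf_chartD[OF assms(4) U]])
      (rule chart_image_open[OF assms(1) U open_Int[OF assms(2) chart_open[OF assms(1) U]]], simp)
  show "vec_deriv A q (X q + Y q) \<phi> = ((\<lambda>p. vec_deriv A p (X p) \<phi>) \<circ> inv_into U \<phi>) (\<phi> q)
      + ((\<lambda>p. vec_deriv A p (Y p) \<phi>) \<circ> inv_into U \<phi>) (\<phi> q)" if "q \<in> U" for q
    using linear_add[OF linear_vec_deriv_chart[OF assms(1) U that]] chart_inv[OF assms(1) U that] by simp
qed

lemma smooth_vf_scaleR:
  assumes "smooth_manifold A" "open S" "smooth_fun A S f" "smooth_vf A S X"
  shows "smooth_vf A S (\<lambda>q. f q *\<^sub>R X q)"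
proof (rule smooth_vfI[OF assms(1,2)])
  fix U \<phi> assume U: "(U, \<phi>) \<in> A"
  show "smooth_on (\<phi> ` (S \<inter> U)) (\<lambda>x. (f \<circ> inv_into U \<phi>) x *\<^sub>R
      ((\<lambda>p. vec_deriv A p (X p) \<phi>) \<circ> inv_into U \<phi>) x)"
    by (rule smooth_on_scaleR[OF _ smooth_fun_chartD[OF assms(3) U] smooth_vf_chartD[OF assms(4) U]])
      (rule chart_image_open[OF assms(1) U open_Int[OF assms(2) chart_open[OF assms(1) U]]], simp)
  show "vec_deriv A q (f q *\<^sub>R X q) \<phi> = (f \<circ> inv_into U \<phi>) (\<phi> q) *\<^sub>R
      ((\<lambda>p. vec_deriv A p (X p) \<phi>) \<circ> inv_into U \<phi>) (\<phi> q)" if "q \<in> U" for q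
    using linear_scale[OF linear_vec_deriv_chart[OF assms(1) U that]] chart_inv[OF assms(1) U that] by simp
qed

lemma smooth_vf_sum:
  assumes "smooth_manifold A" "open S" "finite I" "\<And>i. i \<in> I \<Longrightarrow> smooth_vf A S (X i)"
  shows "smooth_vf A S (\<lambda>q. \<Sum>i\<in>I. X i q)"
  using assms(3,4)
proof (induction I rule: finite_induct)
  case empty
  show ?case
    unfolding sum.empty by (rule smooth_vf_zero[OF assms(1,2)])
next
  case (insert i I)
  have "smooth_vf A S (\<lambda>q. X i q + (\<Sum>i\<in>I. X i q))"
  proof (rule smooth_vf_add[OF assms(1,2)])
    show "smooth_vf A S (\<lambda>q. X i q)"
      by (rule insert.prems) simp
    show "smooth_vf A S (\<lambda>q. \<Sum>i\<in>I. X i q)"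
      by (rule insert.IH, rule insert.prems) simp
  qed
  then show ?case
    by (simp only: sum.insert[OF insert.hyps])
qed

section \<open>Connections and torsion in charts\<close>

lemma affine_connection_cong:
  assumes "affine_connection A nabla" "open S" "smooth_vf A S Y" "smooth_vf A S Z"
    "\<forall>q\<in>S. Y q = Z q" "p \<in> S"
  shows "nabla p v Y = nabla p v Z"
  by (rule assms(1)[unfolded affine_connection_def, THEN conjunct1, THEN spec, THEN spec, THEN spec,
        THEN mp, THEN mp, THEN mp, THEN mp, THEN bspec, THEN spec, OF assms(2-6)])

lemma affine_connection_add:
  assumes "affine_connection A nabla" "open S" "smooth_vf A S Y" "smooth_vf A S Z" "p \<in> S"
  shows "nabla p v (\<lambda>q. Y q + Z q) = nabla p v Y + nabla p v Z"
  by (rule assms(1)[unfolded affine_connection_def, THEN conjunct2, THEN conjunct2, THEN conjunct1,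
        THEN spec, THEN spec, THEN spec, THEN mp, THEN mp, THEN mp, THEN bspec, THEN spec, OF assms(2-5)])

lemma affine_connection_scaleR:
  assumes "affine_connection A nabla" "open S" "smooth_fun A S f" "smooth_vf A S Y" "p \<in> S"
  shows "nabla p v (\<lambda>q. f q *\<^sub>R Y q) = vec_deriv A p v f *\<^sub>R Y p + f p *\<^sub>R nabla p v Y"
  by (rule assms(1)[unfolded affine_connection_def, THEN conjunct2, THEN conjunct2, THEN conjunct2,
        THEN conjunct1, THEN spec, THEN spec, THEN spec, THEN mp, THEN mp, THEN mp, THEN bspec,
        THEN spec, OF assms(2-5)])

lemma affine_connection_sum:
  assumes "smooth_manifold A" "affine_connection A nabla" "open S" "p \<in> S"
    and "finite I" "\<And>i. i \<in> I \<Longrightarrow> smooth_vf A S (Y i)"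
  shows "nabla p v (\<lambda>q. \<Sum>i\<in>I. Y i q) = (\<Sum>i\<in>I. nabla p v (Y i))"
proof -
  \<comment> \<open>Additivity for two zero fields reads \<open>c = c + c\<close>.\<close>
  have zero: "nabla p v (\<lambda>q. 0) = 0"
    using affine_connection_add[OF assms(2,3) smooth_vf_zero smooth_vf_zero assms(4), of v] assms(1,3)
    by simp
  show ?thesis
    using assms(5,6)
  proof (induction I rule: finite_induct)
    case (insert i I)
    have "nabla p v (\<lambda>q. Y i q + (\<Sum>i\<in>I. Y i q)) = nabla p v (Y i) + nabla p v (\<lambda>q. \<Sum>i\<in>I. Y i q)"
      by (rule affine_connection_add[OF assms(2,3) _ smooth_vf_sum[OF assms(1,3) insert.hyps(1)] assms(4)])
        (use insert.prems in auto)
    then show ?case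
      using insert by simp
  qed (simp_all add: zero)
qed

text \<open>The \<Gamma> of the overview: the derivative at \<open>p\<close> of the coordinate frame
  of the chart chosen at \<open>p\<close>, extended linearly in \<open>u\<close> by
  construction.\<close>

definition christoffel ::
  "('m, 'a::euclidean_space) atlas \<Rightarrow> ('m, 'a) conn \<Rightarrow> 'm \<Rightarrow> 'a \<Rightarrow> 'a \<Rightarrow> 'a" where
  "christoffel A nabla p v u =
     (\<Sum>i\<in>Basis. (u \<bullet> i) *\<^sub>R nabla p v (chart_field A (chart_dom A p) (coord A p) (\<lambda>_. i)))"

text \<open>Expand \<open>X\<close> in the coordinate frame and apply the Leibniz rule. The
  expansion is valid on the chart domain only, which is why locality of the connection must be used
  before additivity.\<close>

lemma affine_connection_components:
  assumes M: "smooth_manifold A" and conn: "affine_connection A nabla"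
    and S: "open S" "p \<in> S" and X: "smooth_vf A S X"
  shows "nabla p v X = D (components A p X) (coord A p p) v + christoffel A nabla p v (X p)"
proof -
  let ?U = "chart_dom A p"
  let ?\<phi> = "coord A p"
  let ?E = "\<lambda>i. chart_field A ?U ?\<phi> (\<lambda>_. i)"
  let ?f = "\<lambda>i q. components A p X (?\<phi> q) \<bullet> i"
  let ?W = "S \<inter> ?U"
  note c = chart_at_mem(1)[OF M, of p]
  have W: "open ?W" "p \<in> ?W"
    using S chart_open[OF M c] chart_at_mem(2)[OF M] by auto
  have oW: "open (?\<phi> ` ?W)" and xW: "?\<phi> p \<in> ?\<phi> ` ?W"
    using open_coord_image[OF M S(1)] W(2) by auto
  have XW: "smooth_on (?\<phi> ` ?W) (components A p X)"
    by (rule smooth_on_components[OF M X])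
  have E: "smooth_vf A ?W (?E i)" for i
    by (rule smooth_vf_chart_field[OF M c W(1) _ smooth_on_const[OF oW]]) auto
  have f: "smooth_fun A ?W (?f i)" for i
  proof (rule smooth_fun_chartI[OF M c W(1)])
    have "smooth_on (?\<phi> ` ?W) (\<lambda>x. components A p X x \<bullet> i)"
      by (rule smooth_on_bounded_linear[OF bounded_linear_inner_left oW XW])
    then show "smooth_on (?\<phi> ` ?W) (?f i \<circ> inv_into ?U ?\<phi>)"
      by (rule smooth_on_cong[OF oW, rotated]) (use chart_inv[OF M c] in auto)
  qed auto
  have exp: "X q = (\<Sum>i\<in>Basis. ?f i q *\<^sub>R ?E i q)" if q: "q \<in> ?W" for q
  proof (rule vec_deriv_chart_inject[OF M c])
    show qU: "q \<in> ?U"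
      using q by simp
    note lin = linear_vec_deriv_chart[OF M c qU]
    have "vec_deriv A q (\<Sum>i\<in>Basis. ?f i q *\<^sub>R ?E i q) ?\<phi> = (\<Sum>i\<in>Basis. ?f i q *\<^sub>R i)"
      by (simp add: linear_sum[OF lin] linear_scale[OF lin] vec_deriv_chart_field[OF M c qU])
    then show "vec_deriv A q (X q) ?\<phi> = vec_deriv A q (\<Sum>i\<in>Basis. ?f i q *\<^sub>R ?E i q) ?\<phi>"
      by (simp add: euclidean_representation components_def coord_inv_coord[OF M qU])
  qed
  \<comment> \<open>At \<open>p\<close> the frame is the standard basis, because the tangent space
    at \<open>p\<close> is modelled on this very chart.\<close>
  have Ep: "?E i p = i" for i
    using vec_deriv_chart_field[OF M c chart_at_mem(2)[OF M]] by (simp add: vec_deriv_coord[OF M])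
  have df: "vec_deriv A p v (?f i) = D (components A p X) (?\<phi> p) v \<bullet> i" for i
  proof -
    have "((\<lambda>x. components A p X x \<bullet> i) has_derivative (\<lambda>v. D (components A p X) (?\<phi> p) v \<bullet> i)) (at (?\<phi> p))"
      by (rule has_derivative_inner_left[OF smooth_on_has_derivative[OF oW XW xW]])
    then have "((?f i \<circ> coord_inv A p) has_derivative (\<lambda>v. D (components A p X) (?\<phi> p) v \<bullet> i)) (at (?\<phi> p))"
      by (rule has_derivative_transform_within_open[OF _ oW xW]) (auto simp: coord_inv_coord[OF M])
    then show ?thesis
      unfolding vec_deriv_def by (simp only: D_eqI)
  qed
  have fE: "smooth_vf A ?W (\<lambda>q. ?f i q *\<^sub>R ?E i q)" for i
    by (rule smooth_vf_scaleR[OF M W(1) f E])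
  have "nabla p v X = nabla p v (\<lambda>q. \<Sum>i\<in>Basis. ?f i q *\<^sub>R ?E i q)"
    by (rule affine_connection_cong[OF conn W(1) smooth_vf_subset[OF X]
        smooth_vf_sum[OF M W(1) finite_Basis fE] _ W(2)]) (use exp in auto)
  also have "\<dots> = (\<Sum>i\<in>Basis. nabla p v (\<lambda>q. ?f i q *\<^sub>R ?E i q))"
    by (rule affine_connection_sum[OF M conn W finite_Basis fE])
  also have "\<dots> = (\<Sum>i\<in>Basis. (D (components A p X) (?\<phi> p) v \<bullet> i) *\<^sub>R i + (X p \<bullet> i) *\<^sub>R nabla p v (?E i))"
    by (simp add: affine_connection_scaleR[OF conn W(1) f E W(2)] df Ep components_coord[OF M])
  also have "\<dots> = D (components A p X) (?\<phi> p) v + christoffel A nabla p v (X p)"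
    by (simp add: sum.distrib euclidean_representation christoffel_def)
  finally show ?thesis .
qed

text \<open>The derivatives of the components are exactly the bracket and cancel, leaving an
  expression in the values at \<open>p\<close>.\<close>

lemma torsion_christoffel:
  assumes M: "smooth_manifold A" and conn: "affine_connection A nabla"
    and S: "open S" "p \<in> S" and X: "smooth_vf A S X" and Y: "smooth_vf A S Y"
  shows "torsion A nabla X Y p = christoffel A nabla p (X p) (Y p) - christoffel A nabla p (Y p) (X p)"
  by (simp add: torsion_def lie_bracket_components[OF M S X Y] affine_connection_components[OF M conn S X]
      affine_connection_components[OF M conn S Y])

text \<open>Fields with constant components extend \<open>u\<close> and \<open>v\<close>; any other
  extension gives the same torsion, since the formula sees only the two values.\<close>

lemma torsion_tensor_christoffel:
  assumes M: "smooth_manifold A" and conn: "affine_connection A nabla"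
  shows "torsion_tensor A nabla p u v = christoffel A nabla p u v - christoffel A nabla p v u"
  unfolding torsion_tensor_def
proof (rule the_equality)
  let ?E = "\<lambda>u. chart_field A (chart_dom A p) (coord A p) (\<lambda>_. u)"
  note c = chart_at_mem[OF M, of p]
  have o: "open (chart_dom A p)"
    by (rule chart_open[OF M c(1)])
  have E: "smooth_vf A (chart_dom A p) (?E u)" for u
    by (rule smooth_vf_chart_field[OF M c(1) o order_refl smooth_on_const[OF chart_homeomorphism(2)[OF M c(1)]]])
  have Ep: "?E u p = u" for u
    using vec_deriv_chart_field[OF M c] by (simp add: vec_deriv_coord[OF M])
  show "\<exists>S X Y. open S \<and> p \<in> S \<and> smooth_vf A S X \<and> smooth_vf A S Y \<and> X p = u \<and> Y p = v \<and>
      christoffel A nabla p u v - christoffel A nabla p v u = torsion A nabla X Y p"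
    using torsion_christoffel[OF M conn o c(2) E E, of u v] o c(2) E Ep
    by (intro exI[of _ "chart_dom A p"] exI[of _ "?E u"] exI[of _ "?E v"]) simp
next
  fix w
  assume "\<exists>S X Y. open S \<and> p \<in> S \<and> smooth_vf A S X \<and> smooth_vf A S Y \<and> X p = u \<and> Y p = v \<and>
      w = torsion A nabla X Y p"
  then show "w = christoffel A nabla p u v - christoffel A nabla p v u"
    using torsion_christoffel[OF M conn] by blast
qed

section \<open>Differentiation along an immersion\<close>

abbreviation local_rep ::
  "('n, 'b::euclidean_space) atlas \<Rightarrow> ('m, 'a::euclidean_space) atlas \<Rightarrow> ('n \<Rightarrow> 'm) \<Rightarrow> 'n \<Rightarrow> 'b \<Rightarrow> 'a" where
  "local_rep B A \<iota> p \<equiv> coord A (\<iota> p) \<circ> \<iota> \<circ> coord_inv B p"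

abbreviation local_dom ::
  "('n, 'b::euclidean_space) atlas \<Rightarrow> ('m, 'a::euclidean_space) atlas \<Rightarrow> ('n \<Rightarrow> 'm) \<Rightarrow> 'n \<Rightarrow> 'n set" where
  "local_dom B A \<iota> p \<equiv> chart_dom B p \<inter> \<iota> -` chart_dom A (\<iota> p)"

lemma open_local_dom:
  assumes "smooth_manifold B" "smooth_manifold A" "smooth_map B A \<iota>"
  shows "open (local_dom B A \<iota> p)" "p \<in> local_dom B A \<iota> p"
proof -
  have "open (\<iota> -` chart_dom A (\<iota> p))"
    using assms(3) chart_open[OF assms(2) chart_at_mem(1)[OF assms(2)]]
    by (auto simp: smooth_map_def intro: open_vimage)
  then show "open (local_dom B A \<iota> p)"
    using chart_open[OF assms(1) chart_at_mem(1)[OF assms(1)]] by (rule open_Int[rotated])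
  show "p \<in> local_dom B A \<iota> p"
    using chart_at_mem(2)[OF assms(1)] chart_at_mem(2)[OF assms(2)] by simp
qed

lemma smooth_on_local_rep:
  assumes "smooth_manifold B" "smooth_manifold A" "smooth_map B A \<iota>"
  shows "smooth_on (coord B p ` local_dom B A \<iota> p) (local_rep B A \<iota> p)"
    and "open (coord B p ` local_dom B A \<iota> p)"
proof -
  have *: "\<forall>(U, \<phi>)\<in>B. \<forall>(V, \<psi>)\<in>A. smooth_on (\<phi> ` (U \<inter> \<iota> -` V)) (\<psi> \<circ> \<iota> \<circ> inv_into U \<phi>)"
    using assms(3) unfolding smooth_map_def by (elim conjE)
  from bspec[OF bspec[OF * chart_at_mem(1)[OF assms(1)], unfolded prod.case]
      chart_at_mem(1)[OF assms(2)], unfolded prod.case]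
  show "smooth_on (coord B p ` local_dom B A \<iota> p) (local_rep B A \<iota> p)"
    unfolding coord_inv_eq .
  show "open (coord B p ` local_dom B A \<iota> p)"
    by (rule chart_image_open[OF assms(1) chart_at_mem(1)[OF assms(1)] open_local_dom(1)[OF assms]]) simp
qed

lemma local_rep_has_derivative:
  assumes "smooth_manifold B" "smooth_manifold A" "smooth_map B A \<iota>" "q \<in> local_dom B A \<iota> p"
  shows "(local_rep B A \<iota> p has_derivative D (local_rep B A \<iota> p) (coord B p q)) (at (coord B p q))"
  by (rule smooth_on_has_derivative[OF smooth_on_local_rep(2,1)[OF assms(1-3)] imageI[OF assms(4)]])

lemma tangent_map_eq: "tangent_map B A \<iota> p v = D (local_rep B A \<iota> p) (coord B p p) v"
  by (simp add: tangent_map_def vec_deriv_def)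

lemma linear_tangent_map:
  assumes "smooth_manifold B" "smooth_manifold A" "smooth_map B A \<iota>"
  shows "linear (tangent_map B A \<iota> p)"
  using has_derivative_linear[OF local_rep_has_derivative[OF assms open_local_dom(2)[OF assms]]]
  by (simp add: tangent_map_eq[abs_def])

text \<open>\<open>tangent_map\<close> at \<open>q\<close> is formed in the charts chosen at
  \<open>q\<close> and \<open>\<iota> q\<close>; this rewrites it in those of \<open>p\<close> and
  \<open>\<iota> p\<close>, which stay fixed as \<open>q\<close> moves. Both sides compute the
  derivative of \<open>coord A (\<iota> p) \<circ> \<iota>\<close> along \<open>v\<close>: through
  the chart at \<open>\<iota> q\<close>, and through the chart at \<open>p\<close>.\<close>

lemma vec_deriv_tangent_map:
  assumes MB: "smooth_manifold B" and MA: "smooth_manifold A" and sm: "smooth_map B A \<iota>"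
    and q: "q \<in> local_dom B A \<iota> p"
  shows "vec_deriv A (\<iota> q) (tangent_map B A \<iota> q v) (coord A (\<iota> p)) =
    D (local_rep B A \<iota> p) (coord B p q) (vec_deriv B q v (coord B p))"
proof -
  let ?\<psi> = "coord A (\<iota> p)"
  have dq: "(local_rep B A \<iota> q has_derivative tangent_map B A \<iota> q) (at (coord B q q))"
    using local_rep_has_derivative[OF MB MA sm open_local_dom(2)[OF MB MA sm]]
    by (simp add: tangent_map_eq[abs_def])
  have iq: "\<iota> q \<in> chart_dom A (\<iota> p)" "q \<in> chart_dom B p"
    using q by auto
  let ?\<tau> = "?\<psi> \<circ> coord_inv A (\<iota> q)"
  have eq: "local_rep B A \<iota> q (coord B q q) = coord A (\<iota> q) (\<iota> q)"
    by (simp add: coord_inv_coord[OF MB chart_at_mem(2)[OF MB]])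
  have "(?\<tau> has_derivative D ?\<tau> (coord A (\<iota> q) (\<iota> q))) (at (coord A (\<iota> q) (\<iota> q)))"
    using transition_has_derivative[OF MA chart_at_mem(1)[OF MA] chart_at_mem(1)[OF MA]
        chart_at_mem(2)[OF MA] iq(1)] by (simp add: coord_inv_eq)
  then have "(?\<tau> has_derivative D ?\<tau> (coord A (\<iota> q) (\<iota> q))) (at (local_rep B A \<iota> q (coord B q q)))"
    by (simp only: eq)
  from has_derivative_compose[OF dq this]
  have "((?\<psi> \<circ> \<iota> \<circ> coord_inv B q) has_derivative
      (\<lambda>v. D ?\<tau> (coord A (\<iota> q) (\<iota> q)) (tangent_map B A \<iota> q v))) (at (coord B q q))"
  proof (rule has_derivative_transform_within_open)
    show "open (coord B q ` local_dom B A \<iota> q)" "coord B q q \<in> coord B q ` local_dom B A \<iota> q"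
      using smooth_on_local_rep(2)[OF MB MA sm] open_local_dom(2)[OF MB MA sm] by auto
    show "?\<tau> (local_rep B A \<iota> q x) = (?\<psi> \<circ> \<iota> \<circ> coord_inv B q) x"
      if "x \<in> coord B q ` local_dom B A \<iota> q" for x
      using that coord_inv_coord[OF MB] coord_inv_coord[OF MA] by auto
  qed
  then have "vec_deriv B q v (?\<psi> \<circ> \<iota>) = D ?\<tau> (coord A (\<iota> q) (\<iota> q)) (tangent_map B A \<iota> q v)"
    unfolding vec_deriv_def by (simp only: D_eqI)
  moreover have "vec_deriv B q v (?\<psi> \<circ> \<iota>) =
      D (local_rep B A \<iota> p) (coord B p q) (vec_deriv B q v (coord B p))"
    using vec_deriv_eq[OF MB chart_at_mem(1)[OF MB] iq(2), of "?\<psi> \<circ> \<iota>" "D (local_rep B A \<iota> p) (coord B p q)" v]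
      local_rep_has_derivative[OF MB MA sm q] by (simp add: coord_inv_eq)
  ultimately show ?thesis
    by (simp add: vec_deriv_def)
qed

text \<open>The pushed-forward field along \<open>\<iota>\<close>, in the ambient chart at
  \<open>\<iota> p\<close> but as a function of coordinates on the submanifold. It can thus be
  differentiated without any extension.\<close>

definition push_components ::
  "('n, 'b::euclidean_space) atlas \<Rightarrow> ('m, 'a::euclidean_space) atlas \<Rightarrow> ('n \<Rightarrow> 'm) \<Rightarrow> 'n \<Rightarrow>
   ('n \<Rightarrow> 'b) \<Rightarrow> 'b \<Rightarrow> 'a" where
  "push_components B A \<iota> p Y x = D (local_rep B A \<iota> p) x (components B p Y x)"

lemma push_components_coord:
  assumes "smooth_manifold B" "smooth_manifold A" "smooth_map B A \<iota>" "q \<in> local_dom B A \<iota> p"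
  shows "push_components B A \<iota> p Y (coord B p q) =
    vec_deriv A (\<iota> q) (tangent_map B A \<iota> q (Y q)) (coord A (\<iota> p))"
proof -
  have "q \<in> chart_dom B p"
    using assms(4) by simp
  then show ?thesis
    by (simp add: vec_deriv_tangent_map[OF assms] push_components_def components_def
        coord_inv_coord[OF assms(1)])
qed

lemma smooth_on_push_components:
  assumes "smooth_manifold B" "smooth_manifold A" "smooth_map B A \<iota>" "smooth_vf B UNIV Y"
  shows "smooth_on (coord B p ` local_dom B A \<iota> p) (push_components B A \<iota> p Y)"
proof -
  have "smooth_on (coord B p ` local_dom B A \<iota> p) (components B p Y)"
    using smooth_on_components[OF assms(1,4), of p] by (rule smooth_on_subset) auto
  then show ?thesis
    unfolding push_components_def[abs_def]
    by (rule smooth_on_D_apply[OF smooth_on_local_rep(2,1)[OF assms(1-3)]])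
qed

text \<open>Independence of the extension: composed with \<open>local_rep\<close>, the components of
  \<open>Y'\<close> become \<open>push_components\<close>, so by the chain rule the derivative in a
  tangential direction depends only on \<open>Y\<close>.\<close>

lemma conn_extension:
  assumes MB: "smooth_manifold B" and MA: "smooth_manifold A" and sm: "smooth_map B A \<iota>"
    and conn: "affine_connection A nabla"
    and S: "open S" "\<iota> p \<in> S" and Y': "smooth_vf A S Y'" and W: "open W" "p \<in> W"
    and eq: "\<And>q. q \<in> W \<Longrightarrow> \<iota> q \<in> S \<and> Y' (\<iota> q) = tangent_map B A \<iota> q (Y q)"
  shows "nabla (\<iota> p) (tangent_map B A \<iota> p v) Y' =
    D (push_components B A \<iota> p Y) (coord B p p) v +
    christoffel A nabla (\<iota> p) (tangent_map B A \<iota> p v) (tangent_map B A \<iota> p (Y p))"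
proof -
  let ?F = "local_rep B A \<iota> p"
  let ?x = "coord B p p"
  let ?O = "coord B p ` (W \<inter> local_dom B A \<iota> p)"
  have O: "open ?O"
    by (rule chart_image_open[OF MB chart_at_mem(1)[OF MB] open_Int[OF W(1) open_local_dom(1)[OF MB MA sm]]]) auto
  have x: "?x \<in> ?O"
    using W(2) open_local_dom(2)[OF MB MA sm] by blast
  have F: "?F (coord B p q) = coord A (\<iota> p) (\<iota> q)" if "q \<in> local_dom B A \<iota> p" for q
    using that by (simp add: coord_inv_coord[OF MB])
  have pd: "p \<in> local_dom B A \<iota> p"
    by (rule open_local_dom(2)[OF MB MA sm])
  let ?Y = "components A (\<iota> p) Y'"
  let ?V = "coord A (\<iota> p) ` (S \<inter> chart_dom A (\<iota> p))"
  have "(?Y has_derivative D ?Y (?F ?x)) (at (?F ?x))"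
  proof (rule smooth_on_has_derivative[OF open_coord_image[OF MA S(1)] smooth_on_components[OF MA Y']])
    show "?F ?x \<in> ?V"
      unfolding F[OF pd] using S(2) pd by blast
  qed
  from has_derivative_compose[OF local_rep_has_derivative[OF MB MA sm pd] this]
  have "((\<lambda>x. ?Y (?F x)) has_derivative (\<lambda>v. D ?Y (?F ?x) (D ?F ?x v))) (at ?x)" .
  then have "(push_components B A \<iota> p Y has_derivative (\<lambda>v. D ?Y (?F ?x) (D ?F ?x v))) (at ?x)"
  proof (rule has_derivative_transform_within_open[OF _ O x])
    fix y assume "y \<in> ?O"
    then obtain q where q: "y = coord B p q" "q \<in> W" "q \<in> local_dom B A \<iota> p"
      by blast
    have iq: "\<iota> q \<in> chart_dom A (\<iota> p)"
      using q(3) by simp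
    show "?Y (?F y) = push_components B A \<iota> p Y y"
      unfolding q(1) F[OF q(3)] push_components_coord[OF MB MA sm q(3)] components_def
        coord_inv_coord[OF MA iq] using eq[OF q(2)] by simp
  qed
  then have "D (push_components B A \<iota> p Y) ?x v = D ?Y (coord A (\<iota> p) (\<iota> p)) (tangent_map B A \<iota> p v)"
    by (simp only: D_eqI F[OF pd] tangent_map_eq)
  then show ?thesis
    using affine_connection_components[OF MA conn S Y', of "tangent_map B A \<iota> p v"] eq[OF W(2)] by simp
qed

text \<open>Uniqueness is \<open>conn_extension\<close>. For existence, injectivity of the tangent
  map lets \<open>push_components\<close> be extended off the image in coordinates, and
  \<open>chart_field\<close> turns the result into an ambient field.\<close>

lemma conn_along_eq:
  assumes MB: "smooth_manifold B" and MA: "smooth_manifold A" and im: "immersion B A \<iota>"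
    and conn: "affine_connection A nabla" and Y: "smooth_vf B UNIV Y"
  shows "conn_along B A \<iota> nabla p v Y =
    D (push_components B A \<iota> p Y) (coord B p p) v +
    christoffel A nabla (\<iota> p) (tangent_map B A \<iota> p v) (tangent_map B A \<iota> p (Y p))"
proof -
  have sm: "smooth_map B A \<iota>"
    using im by (simp add: immersion_def)
  let ?F = "local_rep B A \<iota> p"
  let ?x = "coord B p p"
  let ?V = "chart_dom A (\<iota> p)"
  let ?\<psi> = "coord A (\<iota> p)"
  have pd: "p \<in> local_dom B A \<iota> p"
    by (rule open_local_dom(2)[OF MB MA sm])
  have "inj (tangent_map B A \<iota> p)"
    using im by (simp add: immersion_def)
  then have inj: "inj (D ?F ?x)"
    by (simp add: tangent_map_eq[abs_def])
  obtain R T G' where R: "open R" "?x \<in> R" "R \<subseteq> coord B p ` local_dom B A \<iota> p" and T: "open T" "?F ` R \<subseteq> T"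
    and G': "smooth_on T G'" "\<And>x. x \<in> R \<Longrightarrow> G' (?F x) = push_components B A \<iota> p Y x"
    by (rule smooth_extension_along_immersion[OF smooth_on_local_rep(2,1)[OF MB MA sm]
          smooth_on_push_components[OF MB MA sm Y] imageI[OF pd] inj]) (rule that)
  \<comment> \<open>\<open>?W\<close> consists of the points whose coordinates lie in
    \<open>R\<close>, where the extension reproduces the field; \<open>?S\<close> below is where
    ambient coordinates lie in \<open>T\<close>, the domain of \<open>G'\<close>.\<close>
  let ?W = "local_dom B A \<iota> p \<inter> (chart_dom B p \<inter> coord B p -` R)"
  let ?S = "?V \<inter> ?\<psi> -` T"
  let ?Y = "chart_field A ?V ?\<psi> G'"
  note c = chart_at_mem[OF MA, of "\<iota> p"]
  have F: "?F (coord B p q) = ?\<psi> (\<iota> q)" if "q \<in> local_dom B A \<iota> p" for q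
    using that by (simp add: coord_inv_coord[OF MB])
  have W: "open ?W" "p \<in> ?W"
    using open_local_dom(1)[OF MB MA sm] chart_vimage_open[OF MB chart_at_mem(1)[OF MB] R(1)] R(2) pd
    by auto
  have oS: "open ?S"
    by (rule chart_vimage_open[OF MA c(1) T(1)])
  have "smooth_on (?\<psi> ` ?S) G'"
    by (rule smooth_on_subset[OF G'(1)]) auto
  then have Y': "smooth_vf A ?S ?Y"
    by (intro smooth_vf_chart_field[OF MA c(1) oS]) auto
  have ext: "\<iota> q \<in> ?S \<and> ?Y (\<iota> q) = tangent_map B A \<iota> q (Y q)" if "q \<in> ?W" for q
  proof
    have q: "q \<in> local_dom B A \<iota> p" "coord B p q \<in> R" and iq: "\<iota> q \<in> ?V"
      using that by auto
    show "\<iota> q \<in> ?S"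
      using iq subsetD[OF T(2) imageI[OF q(2)]] unfolding F[OF q(1)] by simp
    show "?Y (\<iota> q) = tangent_map B A \<iota> q (Y q)"
    proof (rule vec_deriv_chart_inject[OF MA c(1) iq])
      show "vec_deriv A (\<iota> q) (?Y (\<iota> q)) ?\<psi> = vec_deriv A (\<iota> q) (tangent_map B A \<iota> q (Y q)) ?\<psi>"
        unfolding vec_deriv_chart_field[OF MA c(1) iq] push_components_coord[OF MB MA sm q(1), symmetric]
        using G'(2)[OF q(2)] F[OF q(1)] by simp
    qed
  qed
  have ipS: "\<iota> p \<in> ?S"
    using ext[OF W(2)] by blast
  show ?thesis
    unfolding conn_along_def
  proof (rule the_equality)
    show "\<exists>S W Y'. open S \<and> \<iota> p \<in> S \<and> smooth_vf A S Y' \<and> open W \<and> p \<in> W \<and>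
        (\<forall>q\<in>W. \<iota> q \<in> S \<and> Y' (\<iota> q) = tangent_map B A \<iota> q (Y q)) \<and>
        D (push_components B A \<iota> p Y) ?x v +
        christoffel A nabla (\<iota> p) (tangent_map B A \<iota> p v) (tangent_map B A \<iota> p (Y p)) =
        nabla (\<iota> p) (tangent_map B A \<iota> p v) Y'"
      by (intro exI[of _ ?S] exI[of _ ?W] exI[of _ ?Y] conjI ballI oS ipS Y' W ext
          conn_extension[OF MB MA sm conn oS ipS Y' W ext, symmetric])
  next
    fix w
    assume "\<exists>S W Y'. open S \<and> \<iota> p \<in> S \<and> smooth_vf A S Y' \<and> open W \<and> p \<in> W \<and>
        (\<forall>q\<in>W. \<iota> q \<in> S \<and> Y' (\<iota> q) = tangent_map B A \<iota> q (Y q)) \<and>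
        w = nabla (\<iota> p) (tangent_map B A \<iota> p v) Y'"
    then obtain S W Y' where *: "open S" "\<iota> p \<in> S" "smooth_vf A S Y'" "open W" "p \<in> W"
        "\<forall>q\<in>W. \<iota> q \<in> S \<and> Y' (\<iota> q) = tangent_map B A \<iota> q (Y q)"
        "w = nabla (\<iota> p) (tangent_map B A \<iota> p v) Y'"
      by (elim exE conjE)
    show "w = D (push_components B A \<iota> p Y) ?x v +
        christoffel A nabla (\<iota> p) (tangent_map B A \<iota> p v) (tangent_map B A \<iota> p (Y p))"
      unfolding *(7) by (rule conn_extension[OF MB MA sm conn *(1-5) bspec[OF *(6)]])
  qed
qed

text \<open>Naturality of the bracket for fields known only along \<open>\<iota>\<close>: the second
  derivatives of \<open>local_rep\<close> cancel by symmetry, and its first derivative acts on the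
  bracket upstairs.\<close>

lemma push_components_bracket:
  assumes MB: "smooth_manifold B" and MA: "smooth_manifold A" and sm: "smooth_map B A \<iota>"
    and X: "smooth_vf B UNIV X" and Y: "smooth_vf B UNIV Y"
  shows "D (push_components B A \<iota> p Y) (coord B p p) (X p) -
      D (push_components B A \<iota> p X) (coord B p p) (Y p) = tangent_map B A \<iota> p (lie_bracket B X Y p)"
proof -
  let ?F = "local_rep B A \<iota> p"
  let ?x = "coord B p p"
  let ?O = "coord B p ` local_dom B A \<iota> p"
  have pd: "p \<in> local_dom B A \<iota> p"
    by (rule open_local_dom(2)[OF MB MA sm])
  then have x: "?x \<in> ?O"
    by (rule imageI)
  note F = smooth_on_local_rep[OF MB MA sm, of p]
  note C2 = smooth_on_Ck[OF F(1), of 2]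
  have key: "D (push_components B A \<iota> p Z) ?x v =
      D (\<lambda>y. D ?F y (Z p)) ?x v + D ?F ?x (D (components B p Z) ?x v)" if Z: "smooth_vf B UNIV Z" for Z v
  proof -
    have "smooth_on ?O (components B p Z)"
      using smooth_on_components[OF MB Z, of p] by (rule smooth_on_subset) auto
    from D_D_apply[OF F(2) C2 x smooth_on_has_derivative[OF F(2) this x]]
    show ?thesis
      unfolding push_components_def[abs_def] components_coord[OF MB] by (simp only: D_eqI)
  qed
  have "linear (D ?F ?x)"
    by (rule has_derivative_linear[OF local_rep_has_derivative[OF MB MA sm pd]])
  then show ?thesis
    using second_derivative_symmetric[OF F(2) C2 x, of "X p" "Y p"]
    by (simp add: key X Y tangent_map_eq lie_bracket_components[OF MB open_UNIV UNIV_I X Y] linear_diff)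
qed

lemma conn_along_torsion:
  assumes "smooth_manifold B" "smooth_manifold A" "immersion B A \<iota>" "affine_connection A nabla"
    and "smooth_vf B UNIV X" "smooth_vf B UNIV Y"
  shows "conn_along B A \<iota> nabla p (X p) Y - conn_along B A \<iota> nabla p (Y p) X =
    tangent_map B A \<iota> p (lie_bracket B X Y p) +
    torsion_tensor A nabla (\<iota> p) (tangent_map B A \<iota> p (X p)) (tangent_map B A \<iota> p (Y p))"
proof -
  have "smooth_map B A \<iota>"
    using assms(3) by (simp add: immersion_def)
  from push_components_bracket[OF assms(1,2) this assms(5,6), of p, symmetric] show ?thesis
    by (simp add: conn_along_eq[OF assms(1-4)] assms(5,6) torsion_tensor_christoffel[OF assms(2,4)])
qed

section \<open>The symplectic splitting\<close>

text \<open>\<open>?\<Phi>\<close> encodes the functional \<open>\<beta> u\<close> by its values on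
  the basis. Nondegeneracy makes this endomorphism injective, hence surjective, so every functional
  is reached.\<close>

lemma bilinear_nondegenerate_represent:
  fixes \<beta> :: "'b::euclidean_space \<Rightarrow> 'b \<Rightarrow> real"
  assumes \<beta>: "bilinear \<beta>" and nondeg: "\<And>u. (\<And>v. \<beta> u v = 0) \<Longrightarrow> u = 0" and f: "linear f"
  obtains s where "\<And>v. \<beta> s v = f v"
proof -
  have l1: "linear (\<lambda>u. \<beta> u v)" and l2: "linear (\<beta> u)" for u v
    using \<beta> by (auto simp: bilinear_def)
  let ?\<Phi> = "\<lambda>u. \<Sum>j\<in>Basis. \<beta> u j *\<^sub>R j"
  have lin: "linear ?\<Phi>"
    by (intro linearI)
      (simp_all add: linear_add[OF l1] linear_scale[OF l1] scaleR_left_distrib sum.distrib scaleR_sum_right)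
  have coord: "?\<Phi> u \<bullet> j = \<beta> u j" if "j \<in> Basis" for u j
    using that by simp
  have ext: "g v = h v" if "linear g" "linear h" "\<And>j. j \<in> Basis \<Longrightarrow> g j = h j" for g h :: "'b \<Rightarrow> real" and v
    using linear_euclidean_expand[OF that(1), of v] linear_euclidean_expand[OF that(2), of v] that(3) by simp
  have zero: "linear (\<lambda>v :: 'b. 0 :: real)"
    by (simp add: linear_iff)
  have "inj ?\<Phi>"
    unfolding linear_injective_0[OF lin]
  proof clarify
    fix u assume "?\<Phi> u = 0"
    then have "\<beta> u j = 0" if "j \<in> Basis" for j
      using coord[OF that, of u] by simp
    then have "\<beta> u v = 0" for v
      by (rule ext[OF l2 zero])
    then show "u = 0"
      by (rule nondeg)
  qed
  then have "surj ?\<Phi>"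
    using linear_injective_imp_surjective[OF lin] by simp
  from surjD[OF this, of "\<Sum>j\<in>Basis. f j *\<^sub>R j"]
  obtain s where s: "(\<Sum>j\<in>Basis. f j *\<^sub>R j) = ?\<Phi> s" ..
  have "\<beta> s j = f j" if "j \<in> Basis" for j
    using coord[OF that, of s] that unfolding s[symmetric] by simp
  then have "\<beta> s v = f v" for v
    by (rule ext[OF l2 f])
  then show thesis
    by (rule that)
qed

text \<open>The tangential part of \<open>u\<close> represents the functional
  \<open>\<lambda>v. \<omega> (\<iota> p) u (?t v)\<close> with respect to the pulled-back form.
  Nondegeneracy of that form also makes the two subspaces meet only in 0.\<close>

lemma almost_symplectic_splitting:
  assumes MA: "smooth_manifold A" and \<omega>: "two_form A \<omega>" and N: "almost_symplectic_submanifold B A \<omega> \<iota>"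
  shows "\<exists>s. s \<in> tangent_sub B A \<iota> p \<and> u - s \<in> normal_sub B A \<omega> \<iota> p"
    and "w \<in> tangent_sub B A \<iota> p \<Longrightarrow> w \<in> normal_sub B A \<omega> \<iota> p \<Longrightarrow> w = 0"
proof -
  let ?t = "tangent_map B A \<iota> p"
  have MB: "smooth_manifold B" and sm: "smooth_map B A \<iota>"
    using N by (auto simp: almost_symplectic_submanifold_def immersion_def)
  have lt: "linear ?t"
    by (rule linear_tangent_map[OF MB MA sm])
  have bil: "bilinear (\<omega> (\<iota> p))"
    using \<omega> by (simp add: two_form_def)
  let ?\<beta> = "\<lambda>u v. \<omega> (\<iota> p) (?t u) (?t v)"
  have nondeg: "u = 0" if "\<And>v. ?\<beta> u v = 0" for u
    using N that unfolding almost_symplectic_submanifold_def nondegenerate_def pullback_form_def by blast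
  have comp: "linear (\<lambda>v. \<omega> (\<iota> p) u (?t v))" "linear (\<lambda>v. \<omega> (\<iota> p) (?t v) u)" for u
    using linear_compose[OF lt, of "\<omega> (\<iota> p) u"] linear_compose[OF lt, of "\<lambda>v. \<omega> (\<iota> p) v u"] bil
    by (simp_all add: bilinear_def comp_def)
  have b: "bilinear ?\<beta>"
    using comp by (simp add: bilinear_def)
  obtain s where s: "\<And>v. ?\<beta> s v = \<omega> (\<iota> p) u (?t v)"
    using bilinear_nondegenerate_represent[OF b nondeg comp(1)[of u]] by blast
  show "\<exists>s. s \<in> tangent_sub B A \<iota> p \<and> u - s \<in> normal_sub B A \<omega> \<iota> p"
    by (rule exI[of _ "?t s"]) (simp add: tangent_sub_def normal_sub_def bilinear_lsub[OF bil] s)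
  show "w = 0" if w: "w \<in> tangent_sub B A \<iota> p" "w \<in> normal_sub B A \<omega> \<iota> p"
  proof -
    obtain a where a: "w = ?t a"
      using w(1) by (auto simp: tangent_sub_def)
    have "a = 0"
      using w(2) unfolding a by (intro nondeg) (simp add: normal_sub_def tangent_sub_def)
    then show "w = 0"
      using a linear_0[OF lt] by simp
  qed
qed

section \<open>The two projections of the splitting\<close>

lemma subspace_tangent_sub:
  assumes "smooth_manifold B" "smooth_manifold A" "smooth_map B A \<iota>"
  shows "subspace (tangent_sub B A \<iota> p)"
  unfolding tangent_sub_def by (rule linear_subspace_image[OF linear_tangent_map[OF assms] subspace_UNIV])

lemma subspace_normal_sub:
  assumes "two_form A \<omega>"
  shows "subspace (normal_sub B A \<omega> \<iota> p)"
proof -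
  have "bilinear (\<omega> (\<iota> p))"
    using assms by (simp add: two_form_def)
  then show ?thesis
    by (simp add: subspace_def normal_sub_def bilinear_lzero bilinear_ladd bilinear_lmul)
qed

text \<open>Two candidates differ by a vector in both subspaces, hence by 0. Candidates for the
  normal part correspond to tangential ones under \<open>n \<mapsto> u - n\<close>, so one
  uniqueness argument settles both descriptions.\<close>

lemma tan_part_equality:
  assumes "smooth_manifold A" "two_form A \<omega>" "almost_symplectic_submanifold B A \<omega> \<iota>"
    and "s \<in> tangent_sub B A \<iota> p" "u - s \<in> normal_sub B A \<omega> \<iota> p"
  shows "tan_part B A \<omega> \<iota> p u = s"
    and "nor_part B A \<omega> \<iota> p u = u - s"
proof -
  have sm: "smooth_manifold B" "smooth_map B A \<iota>"
    using assms(3) by (auto simp: almost_symplectic_submanifold_def immersion_def)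
  have uniq: "s' = s" if "s' \<in> tangent_sub B A \<iota> p" "u - s' \<in> normal_sub B A \<omega> \<iota> p" for s'
  proof -
    have "s' - s \<in> tangent_sub B A \<iota> p"
      using subspace_diff[OF subspace_tangent_sub[OF sm(1) assms(1) sm(2)] that(1) assms(4)] .
    moreover have "s' - s \<in> normal_sub B A \<omega> \<iota> p"
      using subspace_diff[OF subspace_normal_sub[OF assms(2)] assms(5) that(2)] by simp
    ultimately have "s' - s = 0"
      by (rule almost_symplectic_splitting(2)[OF assms(1-3)])
    then show ?thesis
      by simp
  qed
  show "tan_part B A \<omega> \<iota> p u = s"
    unfolding tan_part_def
  proof (rule the_equality)
    show "s' = s" if "s' \<in> tangent_sub B A \<iota> p \<and> u - s' \<in> normal_sub B A \<omega> \<iota> p" for s'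
      by (rule uniq[OF conjunct1[OF that] conjunct2[OF that]])
  qed (rule conjI[OF assms(4,5)])
  show "nor_part B A \<omega> \<iota> p u = u - s"
    unfolding nor_part_def
  proof (rule the_equality)
    show "n = u - s" if "n \<in> normal_sub B A \<omega> \<iota> p \<and> u - n \<in> tangent_sub B A \<iota> p" for n
      using uniq[of "u - n"] that by (simp add: algebra_simps)
    show "u - s \<in> normal_sub B A \<omega> \<iota> p \<and> u - (u - s) \<in> tangent_sub B A \<iota> p"
      using assms(4,5) by simp
  qed
qed

lemma tan_part_mem:
  assumes "smooth_manifold A" "two_form A \<omega>" "almost_symplectic_submanifold B A \<omega> \<iota>"
  shows "tan_part B A \<omega> \<iota> p u \<in> tangent_sub B A \<iota> p"
    and "u - tan_part B A \<omega> \<iota> p u \<in> normal_sub B A \<omega> \<iota> p"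
    and "nor_part B A \<omega> \<iota> p u = u - tan_part B A \<omega> \<iota> p u"
proof -
  obtain s where s: "s \<in> tangent_sub B A \<iota> p" "u - s \<in> normal_sub B A \<omega> \<iota> p"
    using almost_symplectic_splitting(1)[OF assms, of p u] by (elim exE conjE)
  note eq = tan_part_equality[OF assms s]
  show "tan_part B A \<omega> \<iota> p u \<in> tangent_sub B A \<iota> p"
    unfolding eq(1) by (rule s(1))
  show "u - tan_part B A \<omega> \<iota> p u \<in> normal_sub B A \<omega> \<iota> p"
    unfolding eq(1) by (rule s(2))
  show "nor_part B A \<omega> \<iota> p u = u - tan_part B A \<omega> \<iota> p u"
    unfolding eq by (rule refl)
qed

lemma tan_part_of_tangent:
  assumes "smooth_manifold A" "two_form A \<omega>" "almost_symplectic_submanifold B A \<omega> \<iota>"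
  shows "tan_part B A \<omega> \<iota> p (tangent_map B A \<iota> p a) = tangent_map B A \<iota> p a"
  by (rule tan_part_equality(1)[OF assms])
    (simp_all add: tangent_sub_def subspace_0[OF subspace_normal_sub[OF assms(2)]])

text \<open>Sums and multiples of tangential parts satisfy the characterization of the tangential
  part of the sum or multiple, both summands being subspaces.\<close>

lemma linear_tan_part:
  assumes "smooth_manifold A" "two_form A \<omega>" "almost_symplectic_submanifold B A \<omega> \<iota>"
  shows "linear (tan_part B A \<omega> \<iota> p)"
proof -
  have sm: "smooth_manifold B" "smooth_map B A \<iota>"
    using assms(3) by (auto simp: almost_symplectic_submanifold_def immersion_def)
  note T = subspace_tangent_sub[OF sm(1) assms(1) sm(2), of p]
    and N = subspace_normal_sub[OF assms(2), of B \<iota> p]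
  let ?T = "tan_part B A \<omega> \<iota> p"
  show ?thesis
  proof (rule linearI)
    fix u w
    have "(u - ?T u) + (w - ?T w) \<in> normal_sub B A \<omega> \<iota> p"
      by (intro subspace_add[OF N] tan_part_mem[OF assms])
    then show "?T (u + w) = ?T u + ?T w"
      by (intro tan_part_equality(1)[OF assms] subspace_add[OF T] tan_part_mem[OF assms])
        (simp add: algebra_simps)
  next
    fix c u
    have "c *\<^sub>R (u - ?T u) \<in> normal_sub B A \<omega> \<iota> p"
      by (intro subspace_scale[OF N] tan_part_mem[OF assms])
    then show "?T (c *\<^sub>R u) = c *\<^sub>R ?T u"
      by (intro tan_part_equality(1)[OF assms] subspace_scale[OF T] tan_part_mem[OF assms])
        (simp add: algebra_simps)
  qed
qed

text \<open>The tangential part lies in the range of the tangent map, and injectivity makes its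
  preimage the one described.\<close>

lemma tangent_map_induced_connection:
  assumes "smooth_manifold A" "two_form A \<omega>" "almost_symplectic_submanifold B A \<omega> \<iota>"
  shows "tangent_map B A \<iota> p (induced_connection B A \<omega> \<iota> nabla p v Y) =
    tan_part B A \<omega> \<iota> p (conn_along B A \<iota> nabla p v Y)"
proof -
  have inj: "inj (tangent_map B A \<iota> p)"
    using assms(3) by (simp add: almost_symplectic_submanifold_def immersion_def)
  obtain w where w: "tangent_map B A \<iota> p w = tan_part B A \<omega> \<iota> p (conn_along B A \<iota> nabla p v Y)"
    using tan_part_mem(1)[OF assms, of p "conn_along B A \<iota> nabla p v Y"]
    unfolding tangent_sub_def by (metis imageE)
  have "induced_connection B A \<omega> \<iota> nabla p v Y = w"
    unfolding induced_connection_def w[symmetric] inj_eq[OF inj] by (rule the_eq_trivial)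
  then show ?thesis
    using w by simp
qed

theorem proposition2p6:
  fixes A :: "('m::{t2_space,second_countable_topology}, 'a::euclidean_space) atlas"
    and B :: "('n::{t2_space,second_countable_topology}, 'b::euclidean_space) atlas"
    and \<omega> :: "'m \<Rightarrow> 'a \<Rightarrow> 'a \<Rightarrow> real"
    and nabla :: "('m, 'a) conn"
    and \<iota> :: "'n \<Rightarrow> 'm"
    and X Y :: "'n \<Rightarrow> 'b"
  assumes "almost_fedosov A \<omega> nabla"
    and "DIM('a) > 4"
    and "almost_symplectic_submanifold B A \<omega> \<iota>"
    and "X \<in> sections B"
    and "Y \<in> sections B"
  shows "(\<forall>p. second_fundamental_form B A \<omega> \<iota> nabla X Y p -
              second_fundamental_form B A \<omega> \<iota> nabla Y X p =
            nor_part B A \<omega> \<iota> p (torsion_tensor A nabla (\<iota> p)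
              (tangent_map B A \<iota> p (X p)) (tangent_map B A \<iota> p (Y p)))) \<and>
         (\<forall>p. tangent_map B A \<iota> p (torsion B (induced_connection B A \<omega> \<iota> nabla) X Y p) =
            tan_part B A \<omega> \<iota> p (torsion_tensor A nabla (\<iota> p)
              (tangent_map B A \<iota> p (X p)) (tangent_map B A \<iota> p (Y p))))"
proof -
  have MA: "smooth_manifold A" and \<omega>: "two_form A \<omega>" and conn: "affine_connection A nabla"
    using assms(1) by (auto simp: almost_fedosov_def almost_symplectic_def)
  have MB: "smooth_manifold B" and im: "immersion B A \<iota>" and sm: "smooth_map B A \<iota>"
    using assms(3) by (auto simp: almost_symplectic_submanifold_def immersion_def)
  have X: "smooth_vf B UNIV X" and Y: "smooth_vf B UNIV Y"
    using assms(4,5) by (auto simp: sections_def)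
  note split = MA \<omega> assms(3)
  have *: "second_fundamental_form B A \<omega> \<iota> nabla X Y p - second_fundamental_form B A \<omega> \<iota> nabla Y X p =
        nor_part B A \<omega> \<iota> p (torsion_tensor A nabla (\<iota> p) (tangent_map B A \<iota> p (X p)) (tangent_map B A \<iota> p (Y p)))"
      "tangent_map B A \<iota> p (torsion B (induced_connection B A \<omega> \<iota> nabla) X Y p) =
        tan_part B A \<omega> \<iota> p (torsion_tensor A nabla (\<iota> p) (tangent_map B A \<iota> p (X p)) (tangent_map B A \<iota> p (Y p)))"
    for p
  proof -
    let ?t = "tangent_map B A \<iota> p"
    let ?T = "tan_part B A \<omega> \<iota> p"
    let ?XY = "conn_along B A \<iota> nabla p (X p) Y"
    let ?YX = "conn_along B A \<iota> nabla p (Y p) X"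
    let ?\<tau> = "torsion_tensor A nabla (\<iota> p) (?t (X p)) (?t (Y p))"
    let ?b = "lie_bracket B X Y p"
    have diff: "?XY - ?YX = ?t ?b + ?\<tau>"
      by (rule conn_along_torsion[OF MB MA im conn X Y])
    \<comment> \<open>Project the structure equation \<open>diff\<close> tangentially; the bracket
      term is already tangent and is left unchanged.\<close>
    have "?T ?XY - ?T ?YX = ?T (?XY - ?YX)"
      using linear_diff[OF linear_tan_part[OF split]] by simp
    also have "\<dots> = ?t ?b + ?T ?\<tau>"
      unfolding diff using linear_add[OF linear_tan_part[OF split]] tan_part_of_tangent[OF split] by simp
    finally have tdiff: "?T ?XY - ?T ?YX = ?t ?b + ?T ?\<tau>" .
    \<comment> \<open>The normal part is treated as vector minus tangential part, so
      \<open>diff\<close> and \<open>tdiff\<close> subtract and the bracket cancels.\<close>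
    have "second_fundamental_form B A \<omega> \<iota> nabla X Y p - second_fundamental_form B A \<omega> \<iota> nabla Y X p
        = (?XY - ?YX) - (?T ?XY - ?T ?YX)"
      by (simp add: second_fundamental_form_def tan_part_mem(3)[OF split])
    also have "\<dots> = ?\<tau> - ?T ?\<tau>"
      unfolding tdiff diff by simp
    finally show "second_fundamental_form B A \<omega> \<iota> nabla X Y p - second_fundamental_form B A \<omega> \<iota> nabla Y X p
        = nor_part B A \<omega> \<iota> p ?\<tau>"
      by (simp add: tan_part_mem(3)[OF split])
    \<comment> \<open>Pushed forward by \<open>?t\<close>, the torsion upstairs becomes
      \<open>?T ?XY - ?T ?YX - ?t ?b\<close>, which \<open>tdiff\<close> evaluates.\<close>
    show "?t (torsion B (induced_connection B A \<omega> \<iota> nabla) X Y p) = ?T ?\<tau>"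
      using tdiff
      by (simp add: torsion_def linear_diff[OF linear_tangent_map[OF MB MA sm]]
          tangent_map_induced_connection[OF split])
  qed
  show ?thesis
    using * by blast
qed

end
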